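(* (Weighted $p$-Bochner formula.) Let $p\in(1,\infty)$, let $(M,g,d\mu)$, $d\mu=e^{-f}dV$, be a smooth metric measure space and let $u$ be a $C^3$ function. Then, wherever $|\nabla u|\neq 0$, $$\frac1p \mathrm{L}_f(|\nabla u|^p)=|\nabla u|^{2p-4}\Big(|{\rm Hess}\,u|^2+p(p-2)(\Delta_\infty u)^2+{\rm Ric}_f(\nabla u,\nabla u)\Big)+|\nabla u|^{p-2}\Big(\langle\nabla\Delta_{p,f}u,\nabla u\rangle-(p-2)\Delta_\infty u\,\Delta_{p,f}u\Big),$$ where $\Delta_\infty u=\frac{{\rm Hess}\,u(\nabla u,\nabla u)}{|\nabla u|^2}$; furthermore, $$\frac1p\mathcal{L}_f(|\nabla u|^p)=|\nabla u|^{2p-4}\Big(|{\rm Hess}\,u|_A^2+{\rm Ric}_f(\nabla u,\nabla u)\Big)+|\nabla u|^{p-2}\langle\nabla u,\nabla\Delta_{p,f}u\rangle,$$ where $|{\rm Hess}\,u|_A^2=A^{ik}A^{jl}u_{ij}u_{kl}$.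
   Context: A smooth metric measure space is a triple $(M,g,d\mu)$, where $(M,g)$ is a complete $n$-dimensional Riemannian manifold, $d\mu=e^{-f}dV$, $f$ is a fixed smooth real-valued function on $M$ and $dV$ is the Riemannian volume measure. ${\rm Ric}_f={\rm Ric}+{\rm Hess}f$, $\Delta_f=\Delta-\nabla f\cdot\nabla$, and $\Delta_{p,f}u=e^f{\rm div}(e^{-f}|\nabla u|^{p-2}\nabla u)$. At points where $\nabla u\ne0$ define the tensor $$A={\rm Id}+(p-2)\frac{\nabla u\otimes\nabla u}{|\nabla u|^2},$$ the linearized operator of $\Delta_{p,f}$ at $u$, $$\mathcal{L}_f(\psi)=e^f{\rm div}\big(e^{-f}|\nabla u|^{p-2}A(\nabla\psi)\big),$$ and $$\mathrm{L}_f(\psi)=|\nabla u|^{p-2}\Delta_f\psi+(p-2)|\nabla u|^{p-4}{\rm Hess}\,\psi(\nabla u,\nabla u).$$ Here $u_{ij}={\rm Hess}\,u(e_i,e_j)$ and $A^{ij}$ are the components with respect to a local orthonormal frame $\{e_i\}$, and repeated indices are summed. *)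

theory Defs
  imports "HOL-Analysis.Analysis"
begin

text \<open>
  The underlying topological space of a manifold is a whole type of class \<open>t2_space\<close> and
  \<open>second_countable_topology\<close>, and \<open>'n\<close> indexes the coordinates, so the dimension is
  \<open>CARD('n)\<close>. A chart is a pair of its domain and its coordinate map. Outside its domain the
  coordinate map is arbitrary.

  Tensors are given by their components in the coordinate frame of a chart \<open>c\<close> around the
  point: a tangent vector is an element of \<open>real ^ 'n\<close>, a bilinear form is a matrix, and a
  vector field on the domain of \<open>c\<close> is a function \<open>'a \<Rightarrow> real ^ 'n\<close>. Every operator below is
  its classical expression in the local coordinates of \<open>c\<close>. By the transformation law in
  \<open>riemannian_metric\<close>, two charts give the same values of scalars on the overlap of their
  domains.
\<close>

type_synonym ('a, 'n) chart = "'a set \<times> ('a \<Rightarrow> real ^ 'n)"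

type_synonym ('a, 'n) metric = "('a, 'n) chart \<Rightarrow> 'a \<Rightarrow> real ^ 'n ^ 'n"

abbreviation chart_dom :: "('a, 'n) chart \<Rightarrow> 'a set" where
  "chart_dom c \<equiv> fst c"

abbreviation chart_image :: "('a, 'n) chart \<Rightarrow> (real ^ 'n) set" where
  "chart_image c \<equiv> snd c ` fst c"

abbreviation chart_inv :: "('a, 'n) chart \<Rightarrow> real ^ 'n \<Rightarrow> 'a" where
  "chart_inv c \<equiv> inv_into (fst c) (snd c)"

section \<open>Smooth manifolds\<close>

text \<open>Intended for open \<open>S\<close>.\<close>

primrec Ck_on :: "nat \<Rightarrow> (real ^ 'n) set \<Rightarrow> (real ^ 'n \<Rightarrow> 'b::real_normed_vector) \<Rightarrow> bool" where
  "Ck_on 0 S h \<longleftrightarrow> continuous_on S h"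
| "Ck_on (Suc k) S h \<longleftrightarrow> (\<forall>x\<in>S. h differentiable (at x)) \<and>
     (\<forall>i. Ck_on k S (\<lambda>x. frechet_derivative h (at x) (axis i 1)))"

definition smooth_atlas ::
    "('a::{t2_space, second_countable_topology}, 'n::finite) chart set \<Rightarrow> bool" where
  "smooth_atlas \<A> \<longleftrightarrow>
     (\<Union>c\<in>\<A>. chart_dom c) = UNIV \<and>
     (\<forall>c\<in>\<A>. open (chart_dom c) \<and> open (chart_image c) \<and>
        homeomorphism (chart_dom c) (chart_image c) (snd c) (chart_inv c)) \<and>
     (\<forall>c\<in>\<A>. \<forall>c'\<in>\<A>. \<forall>k.
        Ck_on k (snd c ` (chart_dom c \<inter> chart_dom c')) (snd c' \<circ> chart_inv c))"

definition Ck_fun ::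
    "nat \<Rightarrow> ('a, 'n::finite) chart set \<Rightarrow> ('a \<Rightarrow> 'b::real_normed_vector) \<Rightarrow> bool" where
  "Ck_fun k \<A> h \<longleftrightarrow> (\<forall>c\<in>\<A>. Ck_on k (chart_image c) (h \<circ> chart_inv c))"

definition smooth_fun ::
    "('a, 'n::finite) chart set \<Rightarrow> ('a \<Rightarrow> 'b::real_normed_vector) \<Rightarrow> bool" where
  "smooth_fun \<A> h \<longleftrightarrow> (\<forall>k. Ck_fun k \<A> h)"

text \<open>The coordinate derivative \<open>\<partial>\<^sub>i h\<close> in the chart \<open>c\<close>, as a function on the manifold.\<close>

definition pd :: "('a, 'n::finite) chart \<Rightarrow> 'n \<Rightarrow> ('a \<Rightarrow> real) \<Rightarrow> 'a \<Rightarrow> real" where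
  "pd c i h q = frechet_derivative (h \<circ> chart_inv c) (at (snd c q)) (axis i 1)"

section \<open>Riemannian metrics\<close>

definition jacobian ::
    "('a, 'n::finite) chart \<Rightarrow> ('a, 'n) chart \<Rightarrow> 'a \<Rightarrow> real ^ 'n ^ 'n" where
  "jacobian c c' q = matrix (frechet_derivative (snd c' \<circ> chart_inv c) (at (snd c q)))"

text \<open>\<open>g c q\<close> is the Gram matrix of the metric at \<open>q\<close> in the coordinate frame of \<open>c\<close>.\<close>

definition riemannian_metric ::
    "('a, 'n::finite) chart set \<Rightarrow> ('a, 'n) metric \<Rightarrow> bool" where
  "riemannian_metric \<A> g \<longleftrightarrow>
     (\<forall>c\<in>\<A>.
        (\<forall>k. Ck_on k (chart_image c) (g c \<circ> chart_inv c)) \<and>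
        (\<forall>q\<in>chart_dom c. transpose (g c q) = g c q \<and> (\<forall>v. v \<noteq> 0 \<longrightarrow> v \<bullet> (g c q *v v) > 0))) \<and>
     (\<forall>c\<in>\<A>. \<forall>c'\<in>\<A>. \<forall>q \<in> chart_dom c \<inter> chart_dom c'.
        g c q = transpose (jacobian c c' q) ** g c' q ** jacobian c c' q)"

definition ginner ::
    "('a, 'n::finite) metric \<Rightarrow> ('a, 'n) chart \<Rightarrow> 'a \<Rightarrow> real ^ 'n \<Rightarrow> real ^ 'n \<Rightarrow> real" where
  "ginner g c q X Y = X \<bullet> (g c q *v Y)"

definition gnorm ::
    "('a, 'n::finite) metric \<Rightarrow> ('a, 'n) chart \<Rightarrow> 'a \<Rightarrow> real ^ 'n \<Rightarrow> real" where
  "gnorm g c q X = sqrt (ginner g c q X X)"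

text \<open>\<open>christoffel g c k i j\<close> is \<open>\<Gamma>\<^sup>k\<^sub>i\<^sub>j\<close>.\<close>

definition christoffel ::
    "('a, 'n::finite) metric \<Rightarrow> ('a, 'n) chart \<Rightarrow> 'n \<Rightarrow> 'n \<Rightarrow> 'n \<Rightarrow> 'a \<Rightarrow> real" where
  "christoffel g c k i j q =
     (1/2) * (\<Sum>l\<in>UNIV. matrix_inv (g c q) $ k $ l *
        (pd c i (\<lambda>r. g c r $ j $ l) q + pd c j (\<lambda>r. g c r $ i $ l) q
          - pd c l (\<lambda>r. g c r $ i $ j) q))"

text \<open>For open \<open>I\<close>; the function \<open>v\<close> is the velocity near \<open>t\<close>.\<close>

definition geodesic_on ::
    "('a::topological_space, 'n::finite) chart set \<Rightarrow> ('a, 'n) metric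
      \<Rightarrow> real set \<Rightarrow> (real \<Rightarrow> 'a) \<Rightarrow> bool" where
  "geodesic_on \<A> g I \<gamma> \<longleftrightarrow> continuous_on I \<gamma> \<and>
     (\<forall>t\<in>I. \<forall>c\<in>\<A>. \<gamma> t \<in> chart_dom c \<longrightarrow>
        (\<exists>v. (\<forall>\<^sub>F s in nhds t. ((snd c \<circ> \<gamma>) has_vector_derivative v s) (at s)) \<and>
             (v has_vector_derivative
                (\<chi> k. - (\<Sum>i\<in>UNIV. \<Sum>j\<in>UNIV. christoffel g c k i j (\<gamma> t) * v t $ i * v t $ j)))
               (at t)))"

definition complete_metric ::
    "('a::topological_space, 'n::finite) chart set \<Rightarrow> ('a, 'n) metric \<Rightarrow> bool" where
  "complete_metric \<A> g \<longleftrightarrow>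
     (\<forall>a b \<gamma>. a < b \<and> geodesic_on \<A> g {a<..<b} \<gamma> \<longrightarrow>
        (\<exists>\<sigma>. geodesic_on \<A> g UNIV \<sigma> \<and> (\<forall>t\<in>{a<..<b}. \<sigma> t = \<gamma> t)))"

text \<open>The second-countable space is a countable union of chart domains, so the following
  condition determines the Borel measure \<open>V\<close>.\<close>

definition riemannian_volume ::
    "('a::topological_space, 'n::finite) chart set \<Rightarrow> ('a, 'n) metric \<Rightarrow> 'a measure \<Rightarrow> bool" where
  "riemannian_volume \<A> g V \<longleftrightarrow> sets V = sets borel \<and>
     (\<forall>c\<in>\<A>. \<forall>B\<in>sets borel. B \<subseteq> chart_dom c \<longrightarrow>
        emeasure V B =
          (\<integral>\<^sup>+x. ennreal (sqrt (det (g c (chart_inv c x)))) * indicator (snd c ` B) x \<partial>lborel))"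

definition smooth_metric_measure_space ::
    "('a::{t2_space, second_countable_topology}, 'n::finite) chart set \<Rightarrow> ('a, 'n) metric
      \<Rightarrow> ('a \<Rightarrow> real) \<Rightarrow> 'a measure \<Rightarrow> bool" where
  "smooth_metric_measure_space \<A> g f \<mu> \<longleftrightarrow>
     smooth_atlas \<A> \<and> riemannian_metric \<A> g \<and> complete_metric \<A> g \<and> smooth_fun \<A> f \<and>
     (\<exists>V. riemannian_volume \<A> g V \<and> \<mu> = density V (\<lambda>q. ennreal (exp (- f q))))"

section \<open>Differential operators\<close>

definition grad ::
    "('a, 'n::finite) metric \<Rightarrow> ('a, 'n) chart \<Rightarrow> ('a \<Rightarrow> real) \<Rightarrow> 'a \<Rightarrow> real ^ 'n" where
  "grad g c h q = matrix_inv (g c q) *v (\<chi> i. pd c i h q)"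

text \<open>The trace of the covariant derivative \<open>\<nabla>X\<close>.\<close>

definition divergence ::
    "('a, 'n::finite) metric \<Rightarrow> ('a, 'n) chart \<Rightarrow> ('a \<Rightarrow> real ^ 'n) \<Rightarrow> 'a \<Rightarrow> real" where
  "divergence g c X q =
     (\<Sum>i\<in>UNIV. pd c i (\<lambda>r. X r $ i) q + (\<Sum>j\<in>UNIV. christoffel g c i i j q * X q $ j))"

definition hess ::
    "('a, 'n::finite) metric \<Rightarrow> ('a, 'n) chart \<Rightarrow> ('a \<Rightarrow> real) \<Rightarrow> 'a
      \<Rightarrow> real ^ 'n \<Rightarrow> real ^ 'n \<Rightarrow> real" where
  "hess g c h q X Y = (\<Sum>i\<in>UNIV. \<Sum>j\<in>UNIV.
     (pd c i (pd c j h) q - (\<Sum>k\<in>UNIV. christoffel g c k i j q * pd c k h q)) * X $ i * Y $ j)"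

text \<open>\<open>riemann g c l k i j\<close> is \<open>R\<^sup>l\<^sub>k\<^sub>i\<^sub>j\<close> with
  \<open>R(\<partial>\<^sub>i, \<partial>\<^sub>j) \<partial>\<^sub>k = \<Sum>\<^sub>l R\<^sup>l\<^sub>k\<^sub>i\<^sub>j \<partial>\<^sub>l\<close> and
  \<open>R(X, Y) Z = \<nabla>\<^sub>X \<nabla>\<^sub>Y Z - \<nabla>\<^sub>Y \<nabla>\<^sub>X Z - \<nabla>\<^sub>[\<^sub>X\<^sub>,\<^sub>Y\<^sub>] Z\<close>;
  \<open>Ric(Y, Z)\<close> is the trace of \<open>X \<mapsto> R(X, Y) Z\<close>, which is positive on round spheres.\<close>

definition riemann ::
    "('a, 'n::finite) metric \<Rightarrow> ('a, 'n) chart \<Rightarrow> 'n \<Rightarrow> 'n \<Rightarrow> 'n \<Rightarrow> 'n \<Rightarrow> 'a \<Rightarrow> real" where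
  "riemann g c l k i j q =
     pd c i (christoffel g c l j k) q - pd c j (christoffel g c l i k) q +
     (\<Sum>m\<in>UNIV. christoffel g c l i m q * christoffel g c m j k q
               - christoffel g c l j m q * christoffel g c m i k q)"

definition ricci ::
    "('a, 'n::finite) metric \<Rightarrow> ('a, 'n) chart \<Rightarrow> 'a \<Rightarrow> real ^ 'n \<Rightarrow> real ^ 'n \<Rightarrow> real" where
  "ricci g c q Y Z =
     (\<Sum>j\<in>UNIV. \<Sum>k\<in>UNIV. (\<Sum>i\<in>UNIV. riemann g c i k i j q) * Y $ j * Z $ k)"

definition ricci_f ::
    "('a, 'n::finite) metric \<Rightarrow> ('a \<Rightarrow> real) \<Rightarrow> ('a, 'n) chart \<Rightarrow> 'a
      \<Rightarrow> real ^ 'n \<Rightarrow> real ^ 'n \<Rightarrow> real" where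
  "ricci_f g f c q X Y = ricci g c q X Y + hess g c f q X Y"

definition laplacian ::
    "('a, 'n::finite) metric \<Rightarrow> ('a, 'n) chart \<Rightarrow> ('a \<Rightarrow> real) \<Rightarrow> 'a \<Rightarrow> real" where
  "laplacian g c h q = divergence g c (grad g c h) q"

definition laplacian_f ::
    "('a, 'n::finite) metric \<Rightarrow> ('a \<Rightarrow> real) \<Rightarrow> ('a, 'n) chart \<Rightarrow> ('a \<Rightarrow> real) \<Rightarrow> 'a \<Rightarrow> real" where
  "laplacian_f g f c h q = laplacian g c h q - ginner g c q (grad g c f q) (grad g c h q)"

definition grad_norm ::
    "('a, 'n::finite) metric \<Rightarrow> ('a, 'n) chart \<Rightarrow> ('a \<Rightarrow> real) \<Rightarrow> 'a \<Rightarrow> real" where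
  "grad_norm g c u q = gnorm g c q (grad g c u q)"

definition p_laplacian_f ::
    "('a, 'n::finite) metric \<Rightarrow> ('a \<Rightarrow> real) \<Rightarrow> real \<Rightarrow> ('a, 'n) chart
      \<Rightarrow> ('a \<Rightarrow> real) \<Rightarrow> 'a \<Rightarrow> real" where
  "p_laplacian_f g f p c u q =
     exp (f q) * divergence g c
       (\<lambda>r. (exp (- f r) * grad_norm g c u r powr (p - 2)) *\<^sub>R grad g c u r) q"

definition inf_laplacian ::
    "('a, 'n::finite) metric \<Rightarrow> ('a, 'n) chart \<Rightarrow> ('a \<Rightarrow> real) \<Rightarrow> 'a \<Rightarrow> real" where
  "inf_laplacian g c u q =
     hess g c u q (grad g c u q) (grad g c u q) / (grad_norm g c u q)\<^sup>2"

section \<open>Linearized operators\<close>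

text \<open>The tensor \<open>A\<close> as an endomorphism of the tangent space.\<close>

definition A_op ::
    "('a, 'n::finite) metric \<Rightarrow> real \<Rightarrow> ('a, 'n) chart \<Rightarrow> ('a \<Rightarrow> real) \<Rightarrow> 'a
      \<Rightarrow> real ^ 'n \<Rightarrow> real ^ 'n" where
  "A_op g p c u q X =
     X + ((p - 2) * ginner g c q (grad g c u q) X / (grad_norm g c u q)\<^sup>2) *\<^sub>R grad g c u q"

definition calL_f ::
    "('a, 'n::finite) metric \<Rightarrow> ('a \<Rightarrow> real) \<Rightarrow> real \<Rightarrow> ('a, 'n) chart
      \<Rightarrow> ('a \<Rightarrow> real) \<Rightarrow> ('a \<Rightarrow> real) \<Rightarrow> 'a \<Rightarrow> real" where
  "calL_f g f p c u \<psi> q =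
     exp (f q) * divergence g c
       (\<lambda>r. (exp (- f r) * grad_norm g c u r powr (p - 2)) *\<^sub>R A_op g p c u r (grad g c \<psi> r)) q"

definition L_f ::
    "('a, 'n::finite) metric \<Rightarrow> ('a \<Rightarrow> real) \<Rightarrow> real \<Rightarrow> ('a, 'n) chart
      \<Rightarrow> ('a \<Rightarrow> real) \<Rightarrow> ('a \<Rightarrow> real) \<Rightarrow> 'a \<Rightarrow> real" where
  "L_f g f p c u \<psi> q =
     grad_norm g c u q powr (p - 2) * laplacian_f g f c \<psi> q +
     (p - 2) * grad_norm g c u q powr (p - 4) * hess g c \<psi> q (grad g c u q) (grad g c u q)"

section \<open>Norms of the Hessian in an orthonormal frame\<close>

definition orthonormal_frame ::
    "('a, 'n::finite) metric \<Rightarrow> ('a, 'n) chart \<Rightarrow> 'a \<Rightarrow> ('n \<Rightarrow> real ^ 'n) \<Rightarrow> bool" where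
  "orthonormal_frame g c q e \<longleftrightarrow>
     (\<forall>i j. ginner g c q (e i) (e j) = (if i = j then 1 else 0))"

definition hess_norm_sq ::
    "('a, 'n::finite) metric \<Rightarrow> ('a, 'n) chart \<Rightarrow> ('n \<Rightarrow> real ^ 'n)
      \<Rightarrow> ('a \<Rightarrow> real) \<Rightarrow> 'a \<Rightarrow> real" where
  "hess_norm_sq g c e u q = (\<Sum>i\<in>UNIV. \<Sum>j\<in>UNIV. (hess g c u q (e i) (e j))\<^sup>2)"

definition A_comp ::
    "('a, 'n::finite) metric \<Rightarrow> real \<Rightarrow> ('a, 'n) chart \<Rightarrow> ('n \<Rightarrow> real ^ 'n)
      \<Rightarrow> ('a \<Rightarrow> real) \<Rightarrow> 'a \<Rightarrow> 'n \<Rightarrow> 'n \<Rightarrow> real" where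
  "A_comp g p c e u q i j = ginner g c q (A_op g p c u q (e i)) (e j)"

definition hess_A_norm_sq ::
    "('a, 'n::finite) metric \<Rightarrow> real \<Rightarrow> ('a, 'n) chart \<Rightarrow> ('n \<Rightarrow> real ^ 'n)
      \<Rightarrow> ('a \<Rightarrow> real) \<Rightarrow> 'a \<Rightarrow> real" where
  "hess_A_norm_sq g p c e u q =
     (\<Sum>i\<in>UNIV. \<Sum>j\<in>UNIV. \<Sum>k\<in>UNIV. \<Sum>l\<in>UNIV.
        A_comp g p c e u q i k * A_comp g p c e u q j l *
        hess g c u q (e i) (e j) * hess g c u q (e k) (e l))"

end

(* Put X = |grad u|^(p-2) grad u, so that p_laplacian_f u is the weighted divergence div_f X. The
   flux in calL_f (|grad u|^p) is p times |grad u|^(p-2) A (|grad u|^(p-2) Hess u (grad u)),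
   and since nabla X = |grad u|^(p-2) A o Hess u, this is p nabla_X X. The second formula is therefore
   the identity div_f (nabla_X X) = tr ((nabla X)^2) + X (div_f X) + Ric_f (X, X), which holds for
   every C^2 vector field and every torsion-free connection. The first formula follows by computing
   calL_f psi - L_f psi for psi = |grad u|^p and expanding |Hess u|_A^2. *)
theory Submission
  imports Defs
begin

section \<open>Functions of class \<open>C\<^sup>k\<close> on open sets\<close>

text \<open>The difficulty lies in regularity and locality. Powers of |grad u| need not be
  differentiable where the gradient vanishes, and the operators differentiate them around the point,
  so the work is done on an open piece \<open>W\<close> of one chart where the gradient has no zero.
  Identities between fluxes are proved on all of \<open>W\<close> and may then be differentiated
  there. Since u is C^3, the field X is C^2, which is what lets the second partial derivatives of
  its components commute. The general vector field identity is essential: nabla X is in general not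
  self-adjoint, so the Bochner formula for gradients does not apply to X, and tr ((nabla X)^2) is
  not the squared norm of nabla X. It is a power of |grad u| times the trace of A H A H with H the
  Hessian, and this trace is |Hess u|_A^2 because A and H are self-adjoint separately. Divergences
  take traces in the coordinate frame, whereas the Hessian norms are sums over an orthonormal frame;
  frame independence of the trace connects the two.\<close>

abbreviation partial :: "'n::finite \<Rightarrow> (real ^ 'n \<Rightarrow> 'b::real_normed_vector) \<Rightarrow> real ^ 'n \<Rightarrow> 'b" where
  "partial i h x \<equiv> frechet_derivative h (at x) (axis i 1)"

text \<open>\<open>frechet_derivative\<close> is a choice among admissible derivatives, so equality
  follows once \<open>h\<close> and \<open>h'\<close> are seen to admit the same ones. This covers
  points without a derivative too.\<close>

lemma frechet_derivative_cong_open: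
  assumes "open S" "x \<in> S" "\<And>y. y \<in> S \<Longrightarrow> h y = h' y"
  shows "frechet_derivative h (at x) = frechet_derivative h' (at x)"
proof -
  have "(h has_derivative D) (at x) \<longleftrightarrow> (h' has_derivative D) (at x)" for D
    using has_derivative_transform_within_open[OF _ assms(1,2)] assms(3) by metis
  then show ?thesis
    by (simp add: frechet_derivative_def)
qed

lemma differentiable_cong_open:
  assumes "open S" "x \<in> S" "\<And>y. y \<in> S \<Longrightarrow> h y = h' y" "h differentiable (at x)"
  shows "h' differentiable (at x)"
  using assms unfolding differentiable_def
  by (metis has_derivative_transform_within_open)

lemma Ck_on_cong:
  assumes "open S" "\<And>y. y \<in> S \<Longrightarrow> h y = h' y" "Ck_on k S h"
  shows "Ck_on k S h'"
  using assms(2,3)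
proof (induction k arbitrary: h h')
  case 0
  then show ?case by (simp cong: continuous_on_cong)
next
  case (Suc k)
  have "\<forall>x\<in>S. h' differentiable (at x)"
  proof
    fix x assume "x \<in> S"
    with Suc.prems show "h' differentiable (at x)"
      by (auto intro: differentiable_cong_open[OF assms(1), of x h])
  qed
  moreover have "Ck_on k S (partial i h')" for i
  proof (rule Suc.IH)
    show "partial i h y = partial i h' y" if "y \<in> S" for y
      using frechet_derivative_cong_open[OF assms(1) that] Suc.prems(1) by metis
    show "Ck_on k S (partial i h)"
      using Suc.prems by simp
  qed
  ultimately show ?case by simp
qed

text \<open>Trades the chosen derivative in \<open>Ck_on\<close> for one given by a formula. The
  inductions on \<open>k\<close> below feed the matching derivative rule to this lemma.\<close>

lemma Ck_on_SucI:
  assumes "open S" "\<And>x. x \<in> S \<Longrightarrow> (h has_derivative h' x) (at x)"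
    and "\<And>i. Ck_on k S (\<lambda>x. h' x (axis i 1))"
  shows "Ck_on (Suc k) S h"
proof -
  have "Ck_on k S (partial i h)" for i
    by (rule Ck_on_cong[OF assms(1) _ assms(3)[of i]]) (simp add: frechet_derivative_at[OF assms(2)])
  then show ?thesis
    using assms(2) by (auto simp: differentiable_def)
qed

lemma Ck_on_SucD:
  assumes "Ck_on (Suc k) S h"
  shows "\<And>x. x \<in> S \<Longrightarrow> (h has_derivative frechet_derivative h (at x)) (at x)"
    and "Ck_on k S (partial i h)"
  using assms by (auto simp: frechet_derivative_works)

lemma Ck_on_Suc_imp: "Ck_on (Suc k) S h \<Longrightarrow> Ck_on k S h"
proof (induction k arbitrary: h)
  case 0
  then show ?case
    by (auto intro!: continuous_at_imp_continuous_on differentiable_imp_continuous_within)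
next
  case (Suc k)
  have "Ck_on k S (partial i h)" for i
  proof (rule Suc.IH)
    show "Ck_on (Suc k) S (partial i h)"
      using Suc.prems unfolding Ck_on.simps(2)[of "Suc k"] by blast
  qed
  then show ?case using Suc.prems by simp
qed

lemma Ck_on_mono: "Ck_on m S h \<Longrightarrow> k \<le> m \<Longrightarrow> Ck_on k S h"
  by (induction m) (auto simp: le_Suc_eq dest: Ck_on_Suc_imp simp del: Ck_on.simps(2))

lemma Ck_on_subset:
  assumes "T \<subseteq> S"
  shows "Ck_on k S h \<Longrightarrow> Ck_on k T h"
  using assms by (induction k arbitrary: h) (auto intro: continuous_on_subset)

section \<open>Closure of C^k under algebraic operations, exponentials and real powers\<close>

lemma Ck_on_const: "open S \<Longrightarrow> Ck_on k S (\<lambda>x. a)"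
  by (induction k arbitrary: a) auto

lemma Ck_on_bounded_linear:
  assumes "open S" "bounded_linear L"
  shows "Ck_on k S h \<Longrightarrow> Ck_on k S (\<lambda>x. L (h x))"
proof (induction k arbitrary: h)
  case 0
  then show ?case
    using bounded_linear.continuous_on[OF assms(2)] by simp
next
  case (Suc k)
  note D = Ck_on_SucD[OF Suc.prems]
  show ?case
    by (rule Ck_on_SucI[OF assms(1) bounded_linear.has_derivative[OF assms(2) D(1)] Suc.IH[OF D(2)]])
qed

lemma Ck_on_add:
  assumes "open S"
  shows "Ck_on k S h \<Longrightarrow> Ck_on k S h' \<Longrightarrow> Ck_on k S (\<lambda>x. h x + h' x)"
proof (induction k arbitrary: h h')
  case 0
  then show ?case by (auto intro: continuous_intros)
next
  case (Suc k)
  note D = Ck_on_SucD[OF Suc.prems(1)] Ck_on_SucD[OF Suc.prems(2)]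
  show ?case
    by (rule Ck_on_SucI[OF assms has_derivative_add[OF D(1,3)] Suc.IH[OF D(2,4)]])
qed

lemma Ck_on_sum:
  assumes "open S" "\<And>a. a \<in> I \<Longrightarrow> Ck_on k S (h a)"
  shows "Ck_on k S (\<lambda>x. \<Sum>a\<in>I. h a x)"
  using assms(2)
  by (induction I rule: infinite_finite_induct) (auto intro: Ck_on_add Ck_on_const assms(1))

lemma Ck_on_mult:
  fixes h h' :: "real ^ 'n \<Rightarrow> real"
  assumes "open S"
  shows "Ck_on k S h \<Longrightarrow> Ck_on k S h' \<Longrightarrow> Ck_on k S (\<lambda>x. h x * h' x)"
proof (induction k arbitrary: h h')
  case 0
  then show ?case by (auto intro: continuous_intros)
next
  case (Suc k)
  note D = Ck_on_SucD[OF Suc.prems(1)] Ck_on_SucD[OF Suc.prems(2)]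
  note C = Suc.prems[THEN Ck_on_Suc_imp]
  show ?case
    by (rule Ck_on_SucI[OF assms has_derivative_mult[OF D(1,3)]
          Ck_on_add[OF assms Suc.IH[OF C(1) D(4)] Suc.IH[OF D(2) C(2)]]])
qed

lemma Ck_on_prod:
  fixes h :: "'a \<Rightarrow> real ^ 'n \<Rightarrow> real"
  assumes "open S" "\<And>a. a \<in> I \<Longrightarrow> Ck_on k S (h a)"
  shows "Ck_on k S (\<lambda>x. \<Prod>a\<in>I. h a x)"
  using assms(2)
  by (induction I rule: infinite_finite_induct) (auto intro: Ck_on_mult Ck_on_const assms(1))

text \<open>The derivative of the reciprocal is a product containing the reciprocal itself, so the
  induction hypothesis for the same \<open>h\<close>, one order lower, closes the step.\<close>

lemma Ck_on_inverse:
  fixes h :: "real ^ 'n \<Rightarrow> real"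
  assumes "open S" "\<And>x. x \<in> S \<Longrightarrow> h x \<noteq> 0"
  shows "Ck_on k S h \<Longrightarrow> Ck_on k S (\<lambda>x. inverse (h x))"
proof (induction k)
  case 0
  then show ?case using assms(2) by (auto intro: continuous_intros)
next
  case (Suc k)
  note D = Ck_on_SucD[OF Suc.prems]
  have IH: "Ck_on k S (\<lambda>x. inverse (h x))"
    using Suc.IH Suc.prems Ck_on_Suc_imp by blast
  show ?case
  proof (rule Ck_on_SucI[OF assms(1)])
    show "((\<lambda>x. inverse (h x)) has_derivative
        (\<lambda>v. - 1 * (inverse (h x) * frechet_derivative h (at x) v * inverse (h x)))) (at x)"
      if "x \<in> S" for x
      using Deriv.has_derivative_inverse[OF assms(2)[OF that] D(1)[OF that]] by simp
    show "Ck_on k S (\<lambda>x. - 1 * (inverse (h x) * partial i h x * inverse (h x)))" for i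
      by (intro Ck_on_mult Ck_on_const assms(1) IH D(2))
  qed
qed

lemma Ck_on_exp:
  fixes h :: "real ^ 'n \<Rightarrow> real"
  assumes "open S"
  shows "Ck_on k S h \<Longrightarrow> Ck_on k S (\<lambda>x. exp (h x))"
proof (induction k)
  case 0
  then show ?case by (auto intro: continuous_intros)
next
  case (Suc k)
  note D = Ck_on_SucD[OF Suc.prems]
  have IH: "Ck_on k S (\<lambda>x. exp (h x))"
    using Suc.IH Suc.prems Ck_on_Suc_imp by blast
  show ?case
  proof (rule Ck_on_SucI[OF assms])
    show "((\<lambda>x. exp (h x)) has_derivative
        (\<lambda>v. exp (h x) * frechet_derivative h (at x) v)) (at x)" if "x \<in> S" for x
      using D(1)[OF that] by (auto intro!: derivative_eq_intros)
    show "Ck_on k S (\<lambda>x. exp (h x) * partial i h x)" for i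
      by (intro Ck_on_mult assms IH D(2))
  qed
qed

lemma has_derivative_powr_const:
  fixes h :: "'a::real_normed_vector \<Rightarrow> real"
  assumes "(h has_derivative h') (at x)" "h x > 0"
  shows "((\<lambda>x. h x powr a) has_derivative (\<lambda>v. a * h x powr (a - 1) * h' v)) (at x)"
proof -
  have "((\<lambda>y. y powr a) has_derivative (*) (a * h x powr (a - 1))) (at (h x))"
    using has_real_derivative_powr[OF assms(2)] by (simp add: has_field_derivative_def)
  from has_derivative_compose[OF assms(1) this] show ?thesis by simp
qed

text \<open>The induction generalizes the exponent because differentiation turns \<open>a\<close>
  into \<open>a - 1\<close>.\<close>

lemma Ck_on_powr:
  fixes h :: "real ^ 'n \<Rightarrow> real"
  assumes "open S" "\<And>x. x \<in> S \<Longrightarrow> h x > 0"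
  shows "Ck_on k S h \<Longrightarrow> Ck_on k S (\<lambda>x. h x powr a)"
proof (induction k arbitrary: a)
  case 0
  then show ?case using assms(2) by (fastforce intro!: continuous_intros)
next
  case (Suc k)
  note D = Ck_on_SucD[OF Suc.prems]
  have IH: "Ck_on k S (\<lambda>x. h x powr a)" for a
    using Suc.IH Suc.prems Ck_on_Suc_imp by blast
  show ?case
    by (rule Ck_on_SucI[OF assms(1) has_derivative_powr_const[OF D(1) assms(2)]])
      (auto intro!: Ck_on_mult Ck_on_const assms(1) IH D(2))
qed

section \<open>Determinants and inverse matrices of class C^k\<close>

lemma Ck_on_det:
  fixes M :: "real ^ 'n \<Rightarrow> real ^ 'm ^ 'm"
  assumes "open S" "\<And>i j. Ck_on k S (\<lambda>x. M x $ i $ j)"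
  shows "Ck_on k S (\<lambda>x. det (M x))"
  unfolding det_def by (intro Ck_on_sum Ck_on_mult Ck_on_prod Ck_on_const assms)

lemma matrix_inv_inverse:
  fixes M :: "real ^ 'm ^ 'm"
  assumes "det M \<noteq> 0"
  shows "M ** matrix_inv M = mat 1" "matrix_inv M ** M = mat 1"
proof -
  have "\<exists>B. M ** B = mat 1 \<and> B ** M = mat 1"
    using assms by (simp add: invertible_det_nz[symmetric] invertible_def)
  from someI_ex[OF this] show "M ** matrix_inv M = mat 1" "matrix_inv M ** M = mat 1"
    by (simp_all add: matrix_inv_def)
qed

text \<open>Cramer's rule with right-hand side \<open>axis j 1\<close> writes an entry of the
  inverse as a quotient of determinants, so that its smoothness reduces to sums, products and
  reciprocals.\<close>

lemma matrix_inv_cofactor: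
  fixes M :: "real ^ 'm ^ 'm"
  assumes "det M \<noteq> 0"
  shows "matrix_inv M $ i $ j = det (\<chi> a b. if b = i then axis j 1 $ a else M $ a $ b) / det M"
proof -
  have "M *v (matrix_inv M *v axis j 1) = axis j 1"
    using matrix_inv_inverse[OF assms] by (simp add: matrix_vector_mul_assoc)
  from cramer[OF assms, THEN iffD1, OF this]
  have "matrix_inv M *v axis j 1 = (\<chi> k. det (\<chi> a b. if b = k then axis j 1 $ a else M $ a $ b) / det M)" .
  then have "(matrix_inv M *v axis j 1) $ i = det (\<chi> a b. if b = i then axis j 1 $ a else M $ a $ b) / det M"
    by simp
  then show ?thesis
    by (simp add: matrix_vector_mul_component inner_axis)
qed

lemma Ck_on_matrix_inv:
  fixes M :: "real ^ 'n \<Rightarrow> real ^ 'm ^ 'm"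
  assumes "open S" "\<And>i j. Ck_on k S (\<lambda>x. M x $ i $ j)" "\<And>x. x \<in> S \<Longrightarrow> det (M x) \<noteq> 0"
  shows "Ck_on k S (\<lambda>x. matrix_inv (M x) $ i $ j)"
proof (rule Ck_on_cong[OF assms(1)])
  let ?N = "\<lambda>x. (\<chi> a b. if b = i then axis j 1 $ a else M x $ a $ b) :: real ^ 'm ^ 'm"
  show "det (?N x) * inverse (det (M x)) = matrix_inv (M x) $ i $ j" if "x \<in> S" for x
    using matrix_inv_cofactor[OF assms(3)[OF that]] by (simp add: divide_inverse)
  have "Ck_on k S (\<lambda>x. ?N x $ a $ b)" for a b
    using assms(2) Ck_on_const[OF assms(1)] by (cases "b = i") simp_all
  then show "Ck_on k S (\<lambda>x. det (?N x) * inverse (det (M x)))"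
    by (intro Ck_on_mult Ck_on_inverse Ck_on_det assms)
qed

text \<open>The mean value theorem is used twice: along \<open>v\<close> for the increment in
  direction \<open>w\<close>, then along \<open>w\<close> for the derivative \<open>h' y v\<close>.
  It is the quantitative step towards symmetry of second derivatives.\<close>

lemma second_difference_mean_value:
  fixes h :: "real ^ 'n \<Rightarrow> real"
  assumes "0 < t" and S: "\<And>a b. \<lbrakk>0 \<le> a; a \<le> t; 0 \<le> b; b \<le> t\<rbrakk> \<Longrightarrow> x + a *\<^sub>R v + b *\<^sub>R w \<in> S"
    and h: "\<And>y. y \<in> S \<Longrightarrow> (h has_derivative h' y) (at y)"
    and k: "\<And>y. y \<in> S \<Longrightarrow> ((\<lambda>y. h' y v) has_derivative h'' y) (at y)"
  shows "\<exists>a b. 0 < a \<and> a < t \<and> 0 < b \<and> b < t \<and>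
    h (x + t *\<^sub>R v + t *\<^sub>R w) - h (x + t *\<^sub>R v) - h (x + t *\<^sub>R w) + h x
      = t\<^sup>2 * h'' (x + a *\<^sub>R v + b *\<^sub>R w) w"
proof -
  have 1: "DERIV (\<lambda>a. h (x + a *\<^sub>R v + b *\<^sub>R w)) a :> h' (x + a *\<^sub>R v + b *\<^sub>R w) v"
    if "0 \<le> a" "a \<le> t" "0 \<le> b" "b \<le> t" for a b
  proof -
    have "((\<lambda>a. x + a *\<^sub>R v + b *\<^sub>R w) has_derivative (\<lambda>s. s *\<^sub>R v)) (at a)"
      by (auto intro!: derivative_eq_intros)
    from has_derivative_compose[OF this h[OF S[OF that]]] show ?thesis
      using linear_scale[OF has_derivative_linear[OF h[OF S[OF that]]]]
      by (simp add: has_field_derivative_def mult_commute_abs)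
  qed
  have 2: "DERIV (\<lambda>b. h' (x + a *\<^sub>R v + b *\<^sub>R w) v) b :> h'' (x + a *\<^sub>R v + b *\<^sub>R w) w"
    if "0 \<le> a" "a \<le> t" "0 \<le> b" "b \<le> t" for a b
  proof -
    have "((\<lambda>b. x + a *\<^sub>R v + b *\<^sub>R w) has_derivative (\<lambda>s. s *\<^sub>R w)) (at b)"
      by (auto intro!: derivative_eq_intros)
    from has_derivative_compose[OF this k[OF S[OF that]]] show ?thesis
      using linear_scale[OF has_derivative_linear[OF k[OF S[OF that]]]]
      by (simp add: has_field_derivative_def mult_commute_abs)
  qed
  have "\<exists>a>0. a < t \<and> (h (x + t *\<^sub>R v + t *\<^sub>R w) - h (x + t *\<^sub>R v + 0 *\<^sub>R w))
      - (h (x + 0 *\<^sub>R v + t *\<^sub>R w) - h (x + 0 *\<^sub>R v + 0 *\<^sub>R w))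
      = (t - 0) * (h' (x + a *\<^sub>R v + t *\<^sub>R w) v - h' (x + a *\<^sub>R v + 0 *\<^sub>R w) v)"
    by (rule MVT2[OF \<open>0 < t\<close>]) (intro DERIV_diff 1; use \<open>0 < t\<close> in simp)
  then obtain a where a: "0 < a" "a < t"
    and eq: "h (x + t *\<^sub>R v + t *\<^sub>R w) - h (x + t *\<^sub>R v) - h (x + t *\<^sub>R w) + h x
      = t * (h' (x + a *\<^sub>R v + t *\<^sub>R w) v - h' (x + a *\<^sub>R v + 0 *\<^sub>R w) v)"
    by (auto simp: algebra_simps)
  have "\<exists>b>0. b < t \<and> h' (x + a *\<^sub>R v + t *\<^sub>R w) v - h' (x + a *\<^sub>R v + 0 *\<^sub>R w) v
      = (t - 0) * h'' (x + a *\<^sub>R v + b *\<^sub>R w) w"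
    by (rule MVT2[OF \<open>0 < t\<close>]) (use a in \<open>auto intro: 2\<close>)
  then show ?thesis
    using a eq by (auto simp: power2_eq_square)
qed

text \<open>The second difference is symmetric in its two directions. Evaluating it in either order
  gives the two mixed derivatives at points close to \<open>x\<close>, and continuity forces them to
  agree at \<open>x\<close>.\<close>

lemma partial_commute:
  fixes h :: "real ^ 'n \<Rightarrow> real"
  assumes "open S" "x \<in> S" "Ck_on 2 S h"
  shows "partial i (partial j h) x = partial j (partial i h) x"
proof (rule ccontr)
  define F G where "F = partial i (partial j h)" and "G = partial j (partial i h)"
  assume "\<not> ?thesis"
  then have e: "dist (F x) (G x) / 2 > 0"
    by (simp add: F_def G_def)
  have h: "Ck_on (Suc (Suc 0)) S h"
    using assms(3) by (simp add: numeral_2_eq_2 del: Ck_on.simps)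
  note D = Ck_on_SucD(1)[OF h] Ck_on_SucD(1)[OF Ck_on_SucD(2)[OF h]]
  have "continuous_on S F" "continuous_on S G"
    using Ck_on_SucD(2)[OF Ck_on_SucD(2)[OF h]] by (simp_all add: F_def G_def)
  then have "isCont F x" "isCont G x"
    using assms(1,2) continuous_on_eq_continuous_at by blast+
  with e obtain d1 d2 where d: "d1 > 0" "d2 > 0"
    "\<And>y. dist y x < d1 \<Longrightarrow> dist (F y) (F x) < dist (F x) (G x) / 2"
    "\<And>y. dist y x < d2 \<Longrightarrow> dist (G y) (G x) < dist (F x) (G x) / 2"
    unfolding continuous_at_eps_delta by metis
  obtain d3 where d3: "d3 > 0" "ball x d3 \<subseteq> S"
    using assms(1,2) openE by blast
  \<comment> \<open>The points used are displaced by at most \<open>a + b \<le> 2 * t\<close>, hence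
    by less than \<open>3 * t\<close>; a third of the smallest radius keeps them in \<open>S\<close>
    and in both continuity neighbourhoods.\<close>
  define t where "t = min d1 (min d2 d3) / 3"
  have t: "t > 0" "3 * t \<le> d1" "3 * t \<le> d2" "3 * t \<le> d3"
    using d d3 by (auto simp: t_def)
  have near: "dist (x + a *\<^sub>R axis i 1 + b *\<^sub>R axis j 1) x < 3 * t"
    if "0 \<le> a" "a \<le> t" "0 \<le> b" "b \<le> t" for a b and i j :: 'n
  proof -
    have "norm (a *\<^sub>R axis i 1 + b *\<^sub>R axis j (1::real)) \<le> a + b"
      using norm_triangle_ineq[of "a *\<^sub>R axis i (1::real)" "b *\<^sub>R axis j 1"] that by simp
    then show ?thesis
      using that t(1) by (simp add: dist_norm add.assoc)
  qed
  have inS: "x + a *\<^sub>R axis i 1 + b *\<^sub>R axis j 1 \<in> S"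
    if "0 \<le> a" "a \<le> t" "0 \<le> b" "b \<le> t" for a b and i j :: 'n
    using near[OF that, of i j] d3(2) t(4) by (auto simp: dist_commute subset_iff)
  obtain a b where ab: "0 < a" "a < t" "0 < b" "b < t" and
    1: "h (x + t *\<^sub>R axis j 1 + t *\<^sub>R axis i 1) - h (x + t *\<^sub>R axis j 1) - h (x + t *\<^sub>R axis i 1) + h x
      = t\<^sup>2 * F (x + a *\<^sub>R axis j 1 + b *\<^sub>R axis i 1)"
    using second_difference_mean_value[OF t(1) inS D(1) D(2)] unfolding F_def by blast
  obtain a' b' where ab': "0 < a'" "a' < t" "0 < b'" "b' < t" and
    2: "h (x + t *\<^sub>R axis i 1 + t *\<^sub>R axis j 1) - h (x + t *\<^sub>R axis i 1) - h (x + t *\<^sub>R axis j 1) + h x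
      = t\<^sup>2 * G (x + a' *\<^sub>R axis i 1 + b' *\<^sub>R axis j 1)"
    using second_difference_mean_value[OF t(1) inS D(1) D(2)] unfolding G_def by blast
  have "t\<^sup>2 * F (x + a *\<^sub>R axis j 1 + b *\<^sub>R axis i 1) = t\<^sup>2 * G (x + a' *\<^sub>R axis i 1 + b' *\<^sub>R axis j 1)"
    using 1 2 by (simp add: algebra_simps)
  then have eq: "F (x + a *\<^sub>R axis j 1 + b *\<^sub>R axis i 1) = G (x + a' *\<^sub>R axis i 1 + b' *\<^sub>R axis j 1)"
    using t(1) by simp
  have "dist (F (x + a *\<^sub>R axis j 1 + b *\<^sub>R axis i 1)) (F x) < dist (F x) (G x) / 2"
    using near[of a b j i] ab t by (intro d) auto
  moreover have "dist (G (x + a' *\<^sub>R axis i 1 + b' *\<^sub>R axis j 1)) (G x) < dist (F x) (G x) / 2"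
    using near[of a' b' i j] ab' t by (intro d) auto
  ultimately show False
    using dist_triangle_half_r[of _ "F x" "dist (F x) (G x)" "G x"] by (metis eq less_irrefl dist_commute)
qed

section \<open>Coordinate derivatives and the Christoffel symbols\<close>

text \<open>\<open>W\<close> may be smaller than the chart domain because the locale is used twice:
  on the whole domain, to show that the set of nonvanishing gradient is open, and then on that
  set.\<close>

locale coordinate_metric =
  fixes c :: "('a, 'n::finite) chart" and g :: "('a, 'n) metric" and W :: "'a set"
  assumes W_dom: "W \<subseteq> chart_dom c"
    and inj_chart: "inj_on (snd c) (chart_dom c)"
    and open_W: "open (snd c ` W)"
    and smooth_metric: "Ck_on k (snd c ` W) (g c \<circ> chart_inv c)"
    and metric_sym: "q \<in> W \<Longrightarrow> transpose (g c q) = g c q"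
    and metric_pos: "q \<in> W \<Longrightarrow> v \<noteq> 0 \<Longrightarrow> v \<bullet> (g c q *v v) > 0"
begin

definition Ck :: "nat \<Rightarrow> ('a \<Rightarrow> real) \<Rightarrow> bool" where
  "Ck k h \<longleftrightarrow> Ck_on k (snd c ` W) (h \<circ> chart_inv c)"

lemma chart_inv_chart [simp]: "q \<in> W \<Longrightarrow> chart_inv c (snd c q) = q"
  using W_dom inj_chart by (auto intro: inv_into_f_f)

lemma Ck_cong:
  assumes "\<And>q. q \<in> W \<Longrightarrow> h q = h' q" "Ck k h"
  shows "Ck k h'"
  unfolding Ck_def
  by (rule Ck_on_cong[OF open_W _ assms(2)[unfolded Ck_def]]) (use assms(1) in auto)

lemma Ck_mono: "Ck m h \<Longrightarrow> k \<le> m \<Longrightarrow> Ck k h"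
  unfolding Ck_def by (rule Ck_on_mono)

lemma Ck_const: "Ck k (\<lambda>q. a)"
  by (simp add: Ck_def comp_def Ck_on_const open_W)

lemma Ck_add: "Ck k h \<Longrightarrow> Ck k h' \<Longrightarrow> Ck k (\<lambda>q. h q + h' q)"
  by (simp add: Ck_def comp_def Ck_on_add open_W)

lemma Ck_mult: "Ck k h \<Longrightarrow> Ck k h' \<Longrightarrow> Ck k (\<lambda>q. h q * h' q)"
  by (simp add: Ck_def comp_def Ck_on_mult open_W)

lemma Ck_diff: "Ck k h \<Longrightarrow> Ck k h' \<Longrightarrow> Ck k (\<lambda>q. h q - h' q)"
  using Ck_add[of k h "\<lambda>q. - 1 * h' q"] Ck_mult[OF Ck_const[of k "- 1"]] by simp

lemma Ck_sum: "(\<And>a. a \<in> I \<Longrightarrow> Ck k (h a)) \<Longrightarrow> Ck k (\<lambda>q. \<Sum>a\<in>I. h a q)"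
  by (simp add: Ck_def comp_def Ck_on_sum open_W)

lemma Ck_exp: "Ck k h \<Longrightarrow> Ck k (\<lambda>q. exp (h q))"
  by (simp add: Ck_def comp_def Ck_on_exp open_W)

lemma Ck_powr: "Ck k h \<Longrightarrow> (\<And>q. q \<in> W \<Longrightarrow> h q > 0) \<Longrightarrow> Ck k (\<lambda>q. h q powr a)"
  unfolding Ck_def comp_def by (rule Ck_on_powr[OF open_W]) auto

lemma Ck_pd:
  assumes "Ck (Suc k) h"
  shows "Ck k (pd c i h)"
  unfolding Ck_def
proof (rule Ck_on_cong[OF open_W])
  show "Ck_on k (snd c ` W) (partial i (h \<circ> chart_inv c))"
    using assms unfolding Ck_def by (rule Ck_on_SucD)
qed (auto simp: pd_def)

lemmas Ck_intros = Ck_const Ck_add Ck_mult Ck_diff Ck_sum Ck_exp Ck_pd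

lemma pd_cong:
  assumes "q \<in> W" "\<And>r. r \<in> W \<Longrightarrow> h r = h' r"
  shows "pd c i h q = pd c i h' q"
  unfolding pd_def
  by (rule fun_cong[OF frechet_derivative_cong_open[OF open_W]]) (use assms in auto)

lemma pd_eqI:
  "((\<lambda>x. h (chart_inv c x)) has_derivative D) (at (snd c q)) \<Longrightarrow> pd c i h q = D (axis i 1)"
  using frechet_derivative_at[of "h \<circ> chart_inv c" D] by (simp add: pd_def comp_def)

lemma pd_has_derivative:
  assumes "q \<in> W" "Ck 1 h"
  obtains D where "((\<lambda>x. h (chart_inv c x)) has_derivative D) (at (snd c q))"
    "\<And>i. D (axis i 1) = pd c i h q"
proof -
  have "h \<circ> chart_inv c differentiable (at (snd c q))"
    using assms by (auto simp: Ck_def)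
  then obtain D where "((\<lambda>x. h (chart_inv c x)) has_derivative D) (at (snd c q))"
    by (auto simp: differentiable_def comp_def)
  note D = this
  show ?thesis
    by (rule that[OF D pd_eqI[OF D, symmetric]])
qed

context
  fixes q assumes q: "q \<in> W"
begin

lemma pd_const: "pd c i (\<lambda>r. a) q = 0"
  by (rule pd_eqI) (rule has_derivative_const)

lemma pd_add:
  assumes "Ck 1 h" "Ck 1 h'"
  shows "pd c i (\<lambda>r. h r + h' r) q = pd c i h q + pd c i h' q"
proof -
  obtain D where D: "((\<lambda>x. h (chart_inv c x)) has_derivative D) (at (snd c q))"
    "\<And>i. D (axis i 1) = pd c i h q" using pd_has_derivative[OF q assms(1)] by blast
  obtain D' where D': "((\<lambda>x. h' (chart_inv c x)) has_derivative D') (at (snd c q))"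
    "\<And>i. D' (axis i 1) = pd c i h' q" using pd_has_derivative[OF q assms(2)] by blast
  show ?thesis
    using pd_eqI[OF has_derivative_add[OF D(1) D'(1)]] D(2) D'(2) by simp
qed

lemma pd_mult:
  assumes "Ck 1 h" "Ck 1 h'"
  shows "pd c i (\<lambda>r. h r * h' r) q = pd c i h q * h' q + h q * pd c i h' q"
proof -
  obtain D where D: "((\<lambda>x. h (chart_inv c x)) has_derivative D) (at (snd c q))"
    "\<And>i. D (axis i 1) = pd c i h q" using pd_has_derivative[OF q assms(1)] by blast
  obtain D' where D': "((\<lambda>x. h' (chart_inv c x)) has_derivative D') (at (snd c q))"
    "\<And>i. D' (axis i 1) = pd c i h' q" using pd_has_derivative[OF q assms(2)] by blast
  show ?thesis
    using pd_eqI[OF has_derivative_mult[OF D(1) D'(1)]] D(2) D'(2) q by simp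
qed

lemma pd_diff:
  assumes "Ck 1 h" "Ck 1 h'"
  shows "pd c i (\<lambda>r. h r - h' r) q = pd c i h q - pd c i h' q"
  using pd_add[OF assms(1) Ck_mult[OF Ck_const[of 1 "- 1"] assms(2)]]
    pd_mult[OF Ck_const[of 1 "- 1"] assms(2)] by (simp add: pd_const)

lemma pd_sum:
  assumes "\<And>a. a \<in> I \<Longrightarrow> Ck 1 (h a)"
  shows "pd c i (\<lambda>r. \<Sum>a\<in>I. h a r) q = (\<Sum>a\<in>I. pd c i (h a) q)"
  using assms
  by (induction I rule: infinite_finite_induct) (simp_all add: pd_const pd_add Ck_sum)

lemma pd_exp:
  assumes "Ck 1 h"
  shows "pd c i (\<lambda>r. exp (h r)) q = exp (h q) * pd c i h q"
proof -
  obtain D where D: "((\<lambda>x. h (chart_inv c x)) has_derivative D) (at (snd c q))"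
    "\<And>i. D (axis i 1) = pd c i h q" using pd_has_derivative[OF q assms] by blast
  show ?thesis
    using pd_eqI[of "\<lambda>r. exp (h r)", OF has_derivative_exp[OF D(1)]] D(2) q by simp
qed

lemma pd_powr:
  assumes "Ck 1 h" "h q > 0"
  shows "pd c i (\<lambda>r. h r powr a) q = a * h q powr (a - 1) * pd c i h q"
proof -
  obtain D where D: "((\<lambda>x. h (chart_inv c x)) has_derivative D) (at (snd c q))"
    "\<And>i. D (axis i 1) = pd c i h q" using pd_has_derivative[OF q assms(1)] by blast
  show ?thesis
    using pd_eqI[OF has_derivative_powr_const[OF D(1), of a]] D(2) q assms(2) by simp
qed

lemma pd_commute:
  assumes "Ck 2 h"
  shows "pd c i (pd c j h) q = pd c j (pd c i h) q"
proof -
  have "pd c i (pd c j h) q = partial i (partial j (h \<circ> chart_inv c)) (snd c q)" for i j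
    unfolding pd_def[of c i "pd c j h"]
    by (rule fun_cong[OF frechet_derivative_cong_open[OF open_W]]) (use q in \<open>auto simp: pd_def\<close>)
  then show ?thesis
    using partial_commute[OF open_W _ assms[unfolded Ck_def]] q by simp
qed

end

section \<open>The metric, its inverse and the Levi-Civita connection\<close>

lemma Ck_metric: "Ck k (\<lambda>q. g c q $ i $ j)"
  unfolding Ck_def comp_def
  using Ck_on_bounded_linear[OF open_W bounded_linear_compose[OF bounded_linear_vec_nth[of j]
        bounded_linear_vec_nth[of i]] smooth_metric[of k]]
  by (simp add: comp_def)

lemma metric_commute: "q \<in> W \<Longrightarrow> g c q $ i $ j = g c q $ j $ i"
  using arg_cong[OF metric_sym[of q], of "\<lambda>M. M $ j $ i"] by (simp add: transpose_def)

lemma det_metric: "q \<in> W \<Longrightarrow> det (g c q) \<noteq> 0"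
proof -
  assume q: "q \<in> W"
  have "v = 0" if "g c q *v v = 0" for v
    using metric_pos[OF q, of v] that by auto
  then show ?thesis
    by (simp add: invertible_det_nz[symmetric] invertible_left_inverse matrix_left_invertible_ker)
qed

lemma Ck_matrix_inv_metric: "Ck k (\<lambda>q. matrix_inv (g c q) $ i $ j)"
  unfolding Ck_def comp_def
proof (rule Ck_on_matrix_inv[OF open_W])
  show "Ck_on k (snd c ` W) (\<lambda>x. g c (chart_inv c x) $ i $ j)" for i j
    using Ck_metric[of k i j] by (simp add: Ck_def comp_def)
qed (auto simp: det_metric)

lemma Ck_christoffel: "Ck k (christoffel g c l i j)"
  unfolding christoffel_def
  by (intro Ck_intros Ck_matrix_inv_metric Ck_metric)

text \<open>Torsion-freeness of the connection. The metric is symmetric on \<open>W\<close> only, so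
  its derivatives are compared through \<open>pd_cong\<close>.\<close>

lemma christoffel_commute:
  assumes "q \<in> W"
  shows "christoffel g c k i j q = christoffel g c k j i q"
proof -
  have "pd c l (\<lambda>r. g c r $ i $ j) q = pd c l (\<lambda>r. g c r $ j $ i) q" for l
    by (rule pd_cong[OF assms]) (rule metric_commute)
  then show ?thesis
    by (simp add: christoffel_def algebra_simps)
qed

text \<open>Lowering the index cancels the inverse metric and leaves the Christoffel symbols of the
  first kind.\<close>

lemma christoffel_lower:
  assumes "q \<in> W"
  shows "(\<Sum>l\<in>UNIV. g c q $ k $ l * christoffel g c l i j q) =
    (1/2) * (pd c i (\<lambda>r. g c r $ j $ k) q + pd c j (\<lambda>r. g c r $ i $ k) q
          - pd c k (\<lambda>r. g c r $ i $ j) q)"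
proof -
  define b :: "real ^ 'n" where "b = (\<chi> k. pd c i (\<lambda>r. g c r $ j $ k) q
    + pd c j (\<lambda>r. g c r $ i $ k) q - pd c k (\<lambda>r. g c r $ i $ j) q)"
  have "christoffel g c l i j q = (1/2) * (matrix_inv (g c q) *v b) $ l" for l
    by (simp add: christoffel_def b_def matrix_vector_mult_def)
  then have "(\<Sum>l\<in>UNIV. g c q $ k $ l * christoffel g c l i j q)
      = (\<Sum>l\<in>UNIV. (1/2) * (g c q $ k $ l * (matrix_inv (g c q) *v b) $ l))"
    by (intro sum.cong refl) simp
  also have "\<dots> = (1/2) * (g c q *v (matrix_inv (g c q) *v b)) $ k"
    unfolding sum_distrib_left[symmetric] by (simp add: matrix_vector_mult_def[of "g c q"])
  also have "\<dots> = (1/2) * b $ k"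
    by (simp add: matrix_vector_mul_assoc matrix_inv_inverse det_metric assms)
  finally show ?thesis by (simp add: b_def)
qed

text \<open>The equation \<open>\<nabla> g = 0\<close>: in the sum of two Christoffel symbols of the
  first kind all derivatives cancel in pairs except two copies of the one on the left.\<close>

lemma metric_compatible:
  assumes "q \<in> W"
  shows "pd c i (\<lambda>r. g c r $ j $ k) q =
    (\<Sum>l\<in>UNIV. g c q $ l $ k * christoffel g c l i j q)
    + (\<Sum>l\<in>UNIV. g c q $ j $ l * christoffel g c l i k q)"
proof -
  have s: "pd c l (\<lambda>r. g c r $ i $ j) q = pd c l (\<lambda>r. g c r $ j $ i) q" for l i j
    by (rule pd_cong[OF assms]) (rule metric_commute)
  have "(\<Sum>l\<in>UNIV. g c q $ l $ k * christoffel g c l i j q)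
      = (\<Sum>l\<in>UNIV. g c q $ k $ l * christoffel g c l i j q)"
    using metric_commute[OF assms] by simp
  then show ?thesis
    unfolding christoffel_lower[OF assms] s[of _ k j] s[of _ k i] s[of _ j i]
    by (simp add: christoffel_lower[OF assms] s[of _ k j] s[of _ k i] s[of _ j i] algebra_simps)
qed

end

section \<open>Covariant derivatives\<close>

lemma sum_swap_outer:
  fixes F :: "'a \<Rightarrow> 'b \<Rightarrow> 'c \<Rightarrow> 'd::comm_monoid_add"
  shows "(\<Sum>j\<in>A. \<Sum>k\<in>B. \<Sum>l\<in>C. F j k l) = (\<Sum>l\<in>C. \<Sum>k\<in>B. \<Sum>j\<in>A. F j k l)"
proof -
  have "(\<Sum>j\<in>A. \<Sum>k\<in>B. \<Sum>l\<in>C. F j k l) = (\<Sum>k\<in>B. \<Sum>j\<in>A. \<Sum>l\<in>C. F j k l)"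
    by (rule sum.swap)
  also have "\<dots> = (\<Sum>k\<in>B. \<Sum>l\<in>C. \<Sum>j\<in>A. F j k l)"
    by (intro sum.cong refl) (rule sum.swap)
  also have "\<dots> = (\<Sum>l\<in>C. \<Sum>k\<in>B. \<Sum>j\<in>A. F j k l)"
    by (rule sum.swap)
  finally show ?thesis .
qed

lemma ginner_add_left: "ginner g c q (X + Y) Z = ginner g c q X Z + ginner g c q Y Z"
  by (simp add: ginner_def inner_add_left)

lemma ginner_add_right: "ginner g c q Z (X + Y) = ginner g c q Z X + ginner g c q Z Y"
  by (simp add: ginner_def inner_add_right matrix_vector_right_distrib)

lemma ginner_scaleR_left: "ginner g c q (a *\<^sub>R X) Z = a * ginner g c q X Z"
  by (simp add: ginner_def)

lemma ginner_scaleR_right: "ginner g c q Z (a *\<^sub>R X) = a * ginner g c q Z X"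
  by (simp add: ginner_def matrix_vector_mult_scaleR)

lemma ginner_sum_left: "ginner g c q (\<Sum>i\<in>I. X i) Z = (\<Sum>i\<in>I. ginner g c q (X i) Z)"
  by (simp add: ginner_def inner_sum_left)

lemma ginner_sum_right: "ginner g c q Z (\<Sum>i\<in>I. X i) = (\<Sum>i\<in>I. ginner g c q Z (X i))"
  by (induction I rule: infinite_finite_induct) (simp_all add: ginner_add_right, simp_all add: ginner_def)

lemmas ginner_linear = ginner_add_left ginner_add_right ginner_scaleR_left ginner_scaleR_right
  ginner_sum_left ginner_sum_right

lemma ginner_eq_sum:
  "ginner g c q X Y = (\<Sum>j\<in>UNIV. \<Sum>k\<in>UNIV. g c q $ j $ k * (X $ j * Y $ k))"
  by (simp add: ginner_def inner_vec_def matrix_vector_mult_def sum_distrib_left mult_ac)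

definition directional ::
    "('a, 'n::finite) chart \<Rightarrow> ('a \<Rightarrow> real) \<Rightarrow> 'a \<Rightarrow> real ^ 'n \<Rightarrow> real" where
  "directional c h q v = (\<Sum>i\<in>UNIV. v $ i * pd c i h q)"

lemma directional_scaleR: "directional c h q (a *\<^sub>R v) = a * directional c h q v"
  by (simp add: directional_def sum_distrib_left mult_ac)

text \<open>\<open>cov g c i Y\<close> is \<open>\<nabla>\<^sub>i Y\<close>, and \<open>covd g c Y q v\<close> is \<open>\<nabla>\<^sub>v Y\<close> at \<open>q\<close>.\<close>

definition cov ::
    "('a, 'n::finite) metric \<Rightarrow> ('a, 'n) chart \<Rightarrow> 'n \<Rightarrow> ('a \<Rightarrow> real ^ 'n) \<Rightarrow> 'a \<Rightarrow> real ^ 'n" where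
  "cov g c i Y q =
     (\<chi> k. pd c i (\<lambda>r. Y r $ k) q + (\<Sum>j\<in>UNIV. christoffel g c k i j q * Y q $ j))"

definition covd ::
    "('a, 'n::finite) metric \<Rightarrow> ('a, 'n) chart \<Rightarrow> ('a \<Rightarrow> real ^ 'n) \<Rightarrow> 'a \<Rightarrow> real ^ 'n \<Rightarrow> real ^ 'n" where
  "covd g c Y q v = (\<Sum>i\<in>UNIV. v $ i *\<^sub>R cov g c i Y q)"

lemma covd_add: "covd g c Y q (v + w) = covd g c Y q v + covd g c Y q w"
  by (simp add: covd_def scaleR_add_left sum.distrib)

lemma covd_scaleR: "covd g c Y q (a *\<^sub>R v) = a *\<^sub>R covd g c Y q v"
  by (simp add: covd_def scaleR_sum_right)

lemma linear_covd: "linear (covd g c Y q)"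
  by (rule linearI) (simp_all add: covd_add covd_scaleR)

lemma covd_axis: "covd g c Y q (axis i 1) = cov g c i Y q"
  by (simp add: covd_def axis_def if_distrib[of "\<lambda>a. a *\<^sub>R _"] cong: if_cong)

lemma divergence_eq: "divergence g c Y q = (\<Sum>i\<in>UNIV. cov g c i Y q $ i)"
  by (simp add: divergence_def cov_def)

lemma hess_axis:
  "hess g c h q (axis i 1) (axis j 1)
    = pd c i (pd c j h) q - (\<Sum>k\<in>UNIV. christoffel g c k i j q * pd c k h q)"
  by (simp add: hess_def axis_def if_distrib[of "\<lambda>a. _ * a"] cong: if_cong)

lemma hess_eq_sum: "hess g c h q X Y =
    (\<Sum>i\<in>UNIV. \<Sum>j\<in>UNIV. hess g c h q (axis i 1) (axis j 1) * (X $ i * Y $ j))"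
  unfolding hess_axis by (simp add: hess_def mult_ac)

text \<open>If \<open>E\<close> has the frame as columns, orthonormality says that
  \<open>transpose E ** g c q\<close> is a left inverse of \<open>E\<close>. For square matrices it
  is then a right inverse, and that is the expansion.\<close>

lemma orthonormal_frame_expansion:
  fixes e :: "'n::finite \<Rightarrow> real ^ 'n"
  assumes "orthonormal_frame g c q e"
  shows "v = (\<Sum>i\<in>UNIV. ginner g c q (e i) v *\<^sub>R e i)"
proof -
  define E :: "real ^ 'n ^ 'n" where "E = (\<chi> a i. e i $ a)"
  have col: "E *v x = (\<Sum>i\<in>UNIV. x $ i *\<^sub>R e i)" for x
    by (simp add: vec_eq_iff matrix_vector_mult_def E_def mult_ac)
  have row: "(transpose E *v x) $ i = e i \<bullet> x" for x i
    by (simp add: matrix_vector_mult_def transpose_def E_def inner_vec_def)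
  have "(transpose E ** g c q ** E) $ i $ j = ginner g c q (e i) (e j)" for i j
  proof -
    have "(transpose E ** g c q ** E) $ i $ j = ((transpose E ** g c q ** E) *v axis j 1) $ i"
      by (simp add: matrix_vector_mul_component inner_axis)
    also have "\<dots> = (transpose E *v (g c q *v (E *v axis j 1))) $ i"
      by (simp add: matrix_vector_mul_assoc matrix_mul_assoc)
    also have "E *v axis j 1 = e j"
      by (simp add: col axis_def if_distrib[of "\<lambda>a. a *\<^sub>R _"] cong: if_cong)
    finally show ?thesis
      by (simp only: row ginner_def)
  qed
  then have "(transpose E ** g c q) ** E = mat 1"
    using assms by (simp add: vec_eq_iff mat_def orthonormal_frame_def)
  then have "E ** (transpose E ** g c q) = mat 1"
    using matrix_left_right_inverse by blast
  then have "E *v (transpose E *v (g c q *v v)) = v"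
    by (simp only: matrix_vector_mul_assoc matrix_mul_assoc matrix_vector_mul_lid)
  then show ?thesis
    unfolding ginner_def row[symmetric] col[symmetric] by (rule sym)
qed

text \<open>Connects coordinate traces, as in \<open>divergence\<close>, with frame sums, as in the
  Hessian norms. Each coordinate vector is expanded in the frame inside \<open>T\<close>; exchanging
  the sums reassembles \<open>T (e i)\<close> from its components.\<close>

lemma trace_orthonormal_frame:
  fixes e :: "'n::finite \<Rightarrow> real ^ 'n"
  assumes e: "orthonormal_frame g c q e" and T: "linear T"
  shows "(\<Sum>i\<in>UNIV. T (axis i 1) $ i) = (\<Sum>i\<in>UNIV. ginner g c q (e i) (T (e i)))"
proof -
  have vec: "(\<Sum>a\<in>UNIV. v $ a *\<^sub>R axis a 1) = v" for v :: "real ^ 'n"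
    by (simp add: vec_eq_iff axis_def if_distrib[of "\<lambda>a. _ * a"] cong: if_cong)
  have "T (axis a 1) $ a = (\<Sum>i\<in>UNIV. ginner g c q (e i) (T (e i) $ a *\<^sub>R axis a 1))" for a
    by (subst orthonormal_frame_expansion[OF e, of "axis a 1"])
      (simp add: linear_sum[OF T] linear_scale[OF T] ginner_scaleR_right mult_ac)
  then have "(\<Sum>a\<in>UNIV. T (axis a 1) $ a)
      = (\<Sum>i\<in>UNIV. \<Sum>a\<in>UNIV. ginner g c q (e i) (T (e i) $ a *\<^sub>R axis a 1))"
    by (subst sum.swap) simp
  then show ?thesis
    by (simp add: ginner_sum_right[symmetric] vec)
qed

lemma parseval:
  assumes "orthonormal_frame g c q e"
  shows "(\<Sum>i\<in>UNIV. ginner g c q v (e i) * ginner g c q (e i) w) = ginner g c q v w"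
  using arg_cong[OF orthonormal_frame_expansion[OF assms, of w], of "ginner g c q v"]
  by (simp add: ginner_linear mult.commute)

context coordinate_metric
begin

declare One_nat_def [simp del]

section \<open>Regularity of vector fields and product rules for the covariant derivative\<close>

definition Ckv :: "nat \<Rightarrow> ('a \<Rightarrow> real ^ 'n) \<Rightarrow> bool" where
  "Ckv k Y \<longleftrightarrow> (\<forall>i. Ck k (\<lambda>q. Y q $ i))"

lemma CkvD: "Ckv k Y \<Longrightarrow> Ck k (\<lambda>q. Y q $ i)"
  by (simp add: Ckv_def)

lemma Ckv_mono: "Ckv m Y \<Longrightarrow> k \<le> m \<Longrightarrow> Ckv k Y"
  using Ck_mono by (auto simp: Ckv_def)

lemma Ckv_scaleR: "Ck k h \<Longrightarrow> Ckv k Y \<Longrightarrow> Ckv k (\<lambda>q. h q *\<^sub>R Y q)"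
  by (simp add: Ckv_def Ck_mult)

lemma Ckv_grad: "Ck (Suc k) h \<Longrightarrow> Ckv k (grad g c h)"
  by (simp add: Ckv_def grad_def matrix_vector_mult_def Ck_sum Ck_mult Ck_matrix_inv_metric Ck_pd)

lemma Ckv_cov: "Ckv (Suc k) Y \<Longrightarrow> Ckv k (cov g c i Y)"
  using Ckv_mono[of "Suc k" Y k] unfolding Ckv_def cov_def vec_lambda_beta
  by (intro allI Ck_add Ck_sum Ck_mult Ck_christoffel Ck_pd) auto

lemma Ckv_covd: "Ckv (Suc k) Y \<Longrightarrow> Ckv k Z \<Longrightarrow> Ckv k (\<lambda>q. covd g c Y q (Z q))"
  using Ckv_cov[of k Y] unfolding Ckv_def covd_def sum_component vector_scaleR_component real_scaleR_def
  by (intro allI Ck_sum Ck_mult) auto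

lemma Ck_ginner: "Ckv k Y \<Longrightarrow> Ckv k Z \<Longrightarrow> Ck k (\<lambda>q. ginner g c q (Y q) (Z q))"
  unfolding ginner_eq_sum by (intro Ck_sum Ck_mult Ck_metric CkvD)

lemma Ck_divergence: "Ckv (Suc k) Y \<Longrightarrow> Ck k (divergence g c Y)"
  using Ckv_cov[of k Y] unfolding divergence_eq[abs_def] Ckv_def by (intro Ck_sum) auto

lemma ginner_commute: "q \<in> W \<Longrightarrow> ginner g c q X Y = ginner g c q Y X"
  using dot_lmul_matrix[of X "transpose (g c q)" Y] metric_sym[of q]
  by (simp add: ginner_def inner_commute flip: vector_transpose_matrix)

lemma ginner_pos: "q \<in> W \<Longrightarrow> X \<noteq> 0 \<Longrightarrow> ginner g c q X X > 0"
  by (simp add: ginner_def metric_pos)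

context
  fixes q assumes q: "q \<in> W"
begin

lemma cov_scaleR:
  assumes "Ck 1 h" "Ckv 1 Y"
  shows "cov g c i (\<lambda>r. h r *\<^sub>R Y r) q = pd c i h q *\<^sub>R Y q + h q *\<^sub>R cov g c i Y q"
  using assms by (simp add: vec_eq_iff cov_def pd_mult[OF q] CkvD algebra_simps sum_distrib_left)

lemma cov_add:
  assumes "Ckv 1 Y" "Ckv 1 Z"
  shows "cov g c i (\<lambda>r. Y r + Z r) q = cov g c i Y q + cov g c i Z q"
  using assms by (simp add: vec_eq_iff cov_def pd_add[OF q] CkvD algebra_simps sum.distrib)

lemma divergence_scaleR:
  assumes "Ck 1 h" "Ckv 1 Y"
  shows "divergence g c (\<lambda>r. h r *\<^sub>R Y r) q = directional c h q (Y q) + h q * divergence g c Y q"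
  by (simp add: divergence_eq cov_scaleR[OF assms] directional_def sum.distrib sum_distrib_left mult_ac)

lemma divergence_add:
  assumes "Ckv 1 Y" "Ckv 1 Z"
  shows "divergence g c (\<lambda>r. Y r + Z r) q = divergence g c Y q + divergence g c Z q"
  by (simp add: divergence_eq cov_add[OF assms] sum.distrib)

text \<open>Agreement on \<open>W\<close> suffices since its image is open; fluxes may thus be
  rewritten by formulas that are available only where the gradient does not vanish.\<close>

lemma divergence_cong:
  assumes "\<And>r. r \<in> W \<Longrightarrow> Y r = Z r"
  shows "divergence g c Y q = divergence g c Z q"
proof -
  have "pd c i (\<lambda>r. Y r $ i) q = pd c i (\<lambda>r. Z r $ i) q" for i
    by (rule pd_cong[OF q]) (simp add: assms)
  then show ?thesis
    by (simp add: divergence_def assms[OF q])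
qed

text \<open>Metric compatibility in the form of a product rule, from which the Hessian and all
  derivatives of |grad u| are computed.\<close>

lemma pd_ginner:
  assumes Y: "Ckv 1 Y" and Z: "Ckv 1 Z"
  shows "pd c i (\<lambda>r. ginner g c r (Y r) (Z r)) q
    = ginner g c q (cov g c i Y q) (Z q) + ginner g c q (Y q) (cov g c i Z q)"
proof -
  let ?G = "\<lambda>j k. g c q $ j $ k" and ?\<Gamma> = "\<lambda>k j. christoffel g c k i j q"
  let ?dY = "\<lambda>j. pd c i (\<lambda>r. Y r $ j) q" and ?dZ = "\<lambda>j. pd c i (\<lambda>r. Z r $ j) q"
  note reg = CkvD[OF Y] CkvD[OF Z] Ck_metric
  have "pd c i (\<lambda>r. ginner g c r (Y r) (Z r)) q = (\<Sum>j\<in>UNIV. \<Sum>k\<in>UNIV.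
      pd c i (\<lambda>r. g c r $ j $ k * (Y r $ j * Z r $ k)) q)"
    unfolding ginner_eq_sum by (simp add: pd_sum[OF q] Ck_sum Ck_mult reg)
  also have "\<dots> = (\<Sum>j\<in>UNIV. \<Sum>k\<in>UNIV. pd c i (\<lambda>r. g c r $ j $ k) q * (Y q $ j * Z q $ k)
      + ?G j k * (?dY j * Z q $ k + Y q $ j * ?dZ k))"
    by (simp add: pd_mult[OF q] Ck_mult reg)
  also have "\<dots> = (\<Sum>j\<in>UNIV. \<Sum>k\<in>UNIV. \<Sum>l\<in>UNIV. ?G l k * ?\<Gamma> l j * (Y q $ j * Z q $ k))
      + (\<Sum>j\<in>UNIV. \<Sum>k\<in>UNIV. \<Sum>l\<in>UNIV. ?G j l * ?\<Gamma> l k * (Y q $ j * Z q $ k))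
      + (\<Sum>j\<in>UNIV. \<Sum>k\<in>UNIV. ?G j k * (?dY j * Z q $ k + Y q $ j * ?dZ k))"
    by (simp add: metric_compatible[OF q] sum.distrib sum_distrib_right distrib_right)
  \<comment> \<open>Relabelling makes both Christoffel sums carry the entry \<open>?G j k\<close>;
    they then complete \<open>?dY\<close> and \<open>?dZ\<close> to covariant derivatives.\<close>
  also have "(\<Sum>j\<in>UNIV. \<Sum>k\<in>UNIV. \<Sum>l\<in>UNIV. ?G l k * ?\<Gamma> l j * (Y q $ j * Z q $ k))
      = (\<Sum>j\<in>UNIV. \<Sum>k\<in>UNIV. \<Sum>l\<in>UNIV. ?G j k * (?\<Gamma> j l * Y q $ l * Z q $ k))"
    by (subst sum_swap_outer) (simp add: mult_ac)
  also have "(\<Sum>j\<in>UNIV. \<Sum>k\<in>UNIV. \<Sum>l\<in>UNIV. ?G j l * ?\<Gamma> l k * (Y q $ j * Z q $ k))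
      = (\<Sum>j\<in>UNIV. \<Sum>k\<in>UNIV. \<Sum>l\<in>UNIV. ?G j k * (Y q $ j * (?\<Gamma> k l * Z q $ l)))"
    by (subst (2) sum.swap) (simp add: mult_ac)
  finally show ?thesis
    by (simp add: ginner_eq_sum cov_def sum.distrib distrib_left distrib_right
        sum_distrib_left sum_distrib_right mult_ac)
qed

lemma ginner_grad: "ginner g c q (grad g c h q) v = directional c h q v"
proof -
  have "ginner g c q v (grad g c h q) = directional c h q v"
    by (simp add: ginner_def grad_def matrix_vector_mul_assoc matrix_inv_inverse det_metric q
        inner_vec_def directional_def)
  then show ?thesis by (simp add: ginner_commute[OF q])
qed

text \<open>By positive definiteness, a nonzero difference would have positive inner product with
  itself. Gradients can thus be read off from directional derivatives without handling the inverse
  metric.\<close>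

lemma grad_eqI:
  assumes "\<And>v. directional c h q v = ginner g c q Z v"
  shows "grad g c h q = Z"
proof (rule ccontr)
  assume "grad g c h q \<noteq> Z"
  then have "ginner g c q (grad g c h q + (- 1) *\<^sub>R Z) (grad g c h q + (- 1) *\<^sub>R Z) > 0"
    by (intro ginner_pos q) simp
  then show False
    using assms by (simp add: ginner_add_left ginner_scaleR_left ginner_grad del: scaleR_minus_left scaleR_minus1_left)
qed

end

text \<open>Differentiate the pairing of grad h with the j-th coordinate field, which is
  \<open>pd c j h\<close>. The term in which the coordinate field is differentiated is exactly the
  Christoffel correction in \<open>hess\<close>.\<close>

lemma ginner_cov_grad:
  assumes q: "q \<in> W" and "Ck 2 h"
  shows "ginner g c q (cov g c i (grad g c h) q) (axis j 1) = hess g c h q (axis i 1) (axis j 1)"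
proof -
  have reg: "Ckv 1 (grad g c h)" "Ckv 1 (\<lambda>r. axis j 1)"
    using assms(2) Ckv_grad[of 1 h] by (simp_all add: Ckv_def Ck_const numeral_2_eq_2)
  have cov: "cov g c i (\<lambda>r. axis j 1) q = (\<chi> k. christoffel g c k i j q)"
    by (simp add: cov_def vec_eq_iff pd_const[OF q] axis_def[of j] if_distrib[of "\<lambda>a. _ * a"] cong: if_cong)
  have dir: "directional c h r (axis j 1) = pd c j h r" for r
    by (simp add: directional_def axis_def if_distrib[of "\<lambda>a. a * _"] cong: if_cong)
  have "pd c i (pd c j h) q = pd c i (\<lambda>r. ginner g c r (grad g c h r) (axis j 1)) q"
    by (rule pd_cong[OF q]) (simp add: ginner_grad dir)
  also have "\<dots> = ginner g c q (cov g c i (grad g c h) q) (axis j 1)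
      + (\<Sum>k\<in>UNIV. christoffel g c k i j q * pd c k h q)"
    by (simp add: pd_ginner[OF q] reg cov ginner_grad[OF q] directional_def)
  finally show ?thesis
    by (simp add: hess_axis)
qed

end

section \<open>The Bochner identity for vector fields\<close>

text \<open>The index algebra of the Bochner identity at one point, on plain arrays:
  \<open>x\<close>, \<open>dx\<close>, \<open>ddx\<close> stand for the components of X and their
  partial derivatives, \<open>\<Gamma>\<close> and \<open>d\<Gamma>\<close> for the Christoffel
  symbols and theirs, and \<open>B i k\<close> for component \<open>k\<close> of the covariant
  derivative along \<open>i\<close>.\<close>

lemma bochner_sums:
  fixes x :: "'n::finite \<Rightarrow> real" and dx :: "'n \<Rightarrow> 'n \<Rightarrow> real" and ddx :: "'n \<Rightarrow> 'n \<Rightarrow> 'n \<Rightarrow> real"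
    and \<Gamma> :: "'n \<Rightarrow> 'n \<Rightarrow> 'n \<Rightarrow> real" and d\<Gamma> :: "'n \<Rightarrow> 'n \<Rightarrow> 'n \<Rightarrow> 'n \<Rightarrow> real"
    and B :: "'n \<Rightarrow> 'n \<Rightarrow> real"
  assumes \<Gamma>: "\<And>k i j. \<Gamma> k i j = \<Gamma> k j i" and ddx: "\<And>i j k. ddx i j k = ddx j i k"
    and B: "\<And>i k. B i k = dx i k + (\<Sum>j\<in>UNIV. \<Gamma> k i j * x j)"
  shows "(\<Sum>k\<in>UNIV. (\<Sum>i\<in>UNIV. dx k i * B i k
        + x i * (ddx k i k + (\<Sum>j\<in>UNIV. d\<Gamma> k k i j * x j + \<Gamma> k i j * dx k j)))
      + (\<Sum>j\<in>UNIV. \<Gamma> k k j * (\<Sum>i\<in>UNIV. x i * B i j)))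
    = (\<Sum>i\<in>UNIV. \<Sum>k\<in>UNIV. B i k * B k i)
      + (\<Sum>i\<in>UNIV. x i * (\<Sum>k\<in>UNIV. ddx i k k + (\<Sum>j\<in>UNIV. d\<Gamma> i k k j * x j + \<Gamma> k k j * dx i j)))
      + (\<Sum>j\<in>UNIV. \<Sum>k\<in>UNIV. (\<Sum>i\<in>UNIV. d\<Gamma> i i j k - d\<Gamma> j i i k
          + (\<Sum>m\<in>UNIV. \<Gamma> i i m * \<Gamma> m j k - \<Gamma> i j m * \<Gamma> m i k)) * x j * x k)"
    (is "?L = ?tr + ?D + ?Ric")
proof -
  \<comment> \<open>The left side is \<open>T1 + T2 + T3 + T4 + T5 + T6\<close>. The trace gives
    \<open>T1 + T4 + Y\<close>, the derivative of the divergence \<open>T2 + U3 + T5\<close>, the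
    Ricci term \<open>T3 - U3 + T6 - Y\<close>, so \<open>U3\<close> and \<open>Y\<close> cancel.
    Symmetry of \<open>\<Gamma>\<close> is used for \<open>T4\<close> and \<open>Y\<close>, symmetry
    of \<open>ddx\<close> for \<open>T2\<close>.\<close>
  define T1 where "T1 = (\<Sum>k\<in>UNIV. \<Sum>i\<in>UNIV. dx k i * B i k)"
  define T2 where "T2 = (\<Sum>k\<in>UNIV. \<Sum>i\<in>UNIV. x i * ddx k i k)"
  define T3 where "T3 = (\<Sum>k\<in>UNIV. \<Sum>i\<in>UNIV. \<Sum>j\<in>UNIV. d\<Gamma> k k i j * x i * x j)"
  define T4 where "T4 = (\<Sum>k\<in>UNIV. \<Sum>i\<in>UNIV. \<Sum>j\<in>UNIV. \<Gamma> k i j * dx k j * x i)"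
  define T5 where "T5 = (\<Sum>k\<in>UNIV. \<Sum>j\<in>UNIV. \<Sum>i\<in>UNIV. \<Gamma> k k j * dx i j * x i)"
  define T6 where "T6 = (\<Sum>k\<in>UNIV. \<Sum>j\<in>UNIV. \<Sum>i\<in>UNIV. \<Sum>m\<in>UNIV. \<Gamma> k k j * \<Gamma> j i m * x i * x m)"
  define U3 where "U3 = (\<Sum>i\<in>UNIV. \<Sum>k\<in>UNIV. \<Sum>j\<in>UNIV. d\<Gamma> i k k j * x i * x j)"
  define Y where "Y = (\<Sum>i\<in>UNIV. \<Sum>k\<in>UNIV. \<Sum>j\<in>UNIV. \<Sum>m\<in>UNIV. \<Gamma> k i j * \<Gamma> i k m * x j * x m)"
  have L: "?L = T1 + T2 + T3 + T4 + T5 + T6"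
    unfolding T1_def T2_def T3_def T4_def T5_def T6_def B
    by (simp add: sum.distrib sum_distrib_left sum_distrib_right distrib_left distrib_right mult_ac)
  have tr1: "?tr = (\<Sum>i\<in>UNIV. \<Sum>k\<in>UNIV. B i k * dx k i)
      + (\<Sum>i\<in>UNIV. \<Sum>k\<in>UNIV. \<Sum>j\<in>UNIV. \<Gamma> i k j * dx i k * x j) + Y"
    unfolding Y_def B
    by (simp add: sum.distrib sum_distrib_left sum_distrib_right distrib_left distrib_right mult_ac)
  have tr2: "(\<Sum>i\<in>UNIV. \<Sum>k\<in>UNIV. B i k * dx k i) = T1"
    unfolding T1_def by (subst sum.swap) (simp add: mult.commute)
  have tr3: "(\<Sum>i\<in>UNIV. \<Sum>k\<in>UNIV. \<Sum>j\<in>UNIV. \<Gamma> i k j * dx i k * x j) = T4"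
    unfolding T4_def sum.cartesian_product
    by (rule sum.reindex_bij_witness[of _ "\<lambda>(i, j, k). (i, k, j)" "\<lambda>(i, k, j). (i, j, k)"])
      (auto simp: \<Gamma>)
  have D1: "?D = (\<Sum>i\<in>UNIV. \<Sum>k\<in>UNIV. x i * ddx i k k) + U3
      + (\<Sum>i\<in>UNIV. \<Sum>k\<in>UNIV. \<Sum>j\<in>UNIV. \<Gamma> k k j * dx i j * x i)"
    unfolding U3_def
    by (simp add: sum.distrib sum_distrib_left sum_distrib_right distrib_left distrib_right mult_ac)
  have D2: "(\<Sum>i\<in>UNIV. \<Sum>k\<in>UNIV. x i * ddx i k k) = T2"
    unfolding T2_def by (subst sum.swap) (simp add: ddx)
  have D3: "(\<Sum>i\<in>UNIV. \<Sum>k\<in>UNIV. \<Sum>j\<in>UNIV. \<Gamma> k k j * dx i j * x i) = T5"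
    unfolding T5_def sum.cartesian_product
    by (rule sum.reindex_bij_witness[of _ "\<lambda>(k, j, i). (i, k, j)" "\<lambda>(i, k, j). (k, j, i)"]) auto
  have R1: "?Ric = (\<Sum>j\<in>UNIV. \<Sum>k\<in>UNIV. \<Sum>i\<in>UNIV. d\<Gamma> i i j k * x j * x k)
      - (\<Sum>j\<in>UNIV. \<Sum>k\<in>UNIV. \<Sum>i\<in>UNIV. d\<Gamma> j i i k * x j * x k)
      + (\<Sum>j\<in>UNIV. \<Sum>k\<in>UNIV. \<Sum>i\<in>UNIV. \<Sum>m\<in>UNIV. \<Gamma> i i m * \<Gamma> m j k * x j * x k)
      - (\<Sum>j\<in>UNIV. \<Sum>k\<in>UNIV. \<Sum>i\<in>UNIV. \<Sum>m\<in>UNIV. \<Gamma> i j m * \<Gamma> m i k * x j * x k)"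
    by (simp add: sum.distrib sum_subtractf sum_distrib_left sum_distrib_right distrib_left
        distrib_right left_diff_distrib)
  have R2: "(\<Sum>j\<in>UNIV. \<Sum>k\<in>UNIV. \<Sum>i\<in>UNIV. d\<Gamma> i i j k * x j * x k) = T3"
    unfolding T3_def sum.cartesian_product
    by (rule sum.reindex_bij_witness[of _ "\<lambda>(i, j, k). (j, k, i)" "\<lambda>(j, k, i). (i, j, k)"]) auto
  have R3: "(\<Sum>j\<in>UNIV. \<Sum>k\<in>UNIV. \<Sum>i\<in>UNIV. d\<Gamma> j i i k * x j * x k) = U3"
    unfolding U3_def sum.cartesian_product
    by (rule sum.reindex_bij_witness[of _ "\<lambda>(j, i, k). (j, k, i)" "\<lambda>(j, k, i). (j, i, k)"]) auto
  have R4: "(\<Sum>j\<in>UNIV. \<Sum>k\<in>UNIV. \<Sum>i\<in>UNIV. \<Sum>m\<in>UNIV. \<Gamma> i i m * \<Gamma> m j k * x j * x k) = T6"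
    unfolding T6_def sum.cartesian_product
    by (rule sum.reindex_bij_witness[of _ "\<lambda>(i, m, j, k). (j, k, i, m)" "\<lambda>(j, k, i, m). (i, m, j, k)"]) auto
  have R5: "(\<Sum>j\<in>UNIV. \<Sum>k\<in>UNIV. \<Sum>i\<in>UNIV. \<Sum>m\<in>UNIV. \<Gamma> i j m * \<Gamma> m i k * x j * x k) = Y"
    unfolding Y_def sum.cartesian_product
    by (rule sum.reindex_bij_witness[of _ "\<lambda>(m, i, j, k). (j, k, i, m)" "\<lambda>(j, k, i, m). (m, i, j, k)"])
      (auto simp: \<Gamma>)
  show ?thesis
    unfolding L tr1 tr2 tr3 D1 D2 D3 R1 R2 R3 R4 R5 by simp
qed

context coordinate_metric
begin

text \<open>The second derivatives of X on the two sides differ only in the order of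
  differentiation. Once they are exchanged, the remaining Christoffel terms form the contracted
  curvature tensor.\<close>

lemma divergence_covd:
  assumes q: "q \<in> W" and X: "Ckv 2 X"
  shows "divergence g c (\<lambda>r. covd g c X r (X r)) q =
    (\<Sum>i\<in>UNIV. covd g c X q (cov g c i X q) $ i)
    + directional c (divergence g c X) q (X q) + ricci g c q (X q) (X q)"
proof -
  let ?x = "\<lambda>i. X q $ i" and ?dx = "\<lambda>i j. pd c i (\<lambda>r. X r $ j) q"
    and ?ddx = "\<lambda>i j k. pd c i (pd c j (\<lambda>r. X r $ k)) q"
    and ?\<Gamma> = "\<lambda>k i j. christoffel g c k i j q"
    and ?d\<Gamma> = "\<lambda>a k i j. pd c a (christoffel g c k i j) q" and ?B = "\<lambda>i k. cov g c i X q $ k"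
  have X1: "Ckv 1 X" using Ckv_mono[OF X] by simp
  have cX: "Ckv 1 (cov g c i X)" for i
    using Ckv_cov[of 1 X i] X by (simp add: numeral_2_eq_2 One_nat_def)
  have dX: "Ck 1 (pd c i (\<lambda>r. X r $ k))" for i k
    using Ck_pd[of 1 "\<lambda>r. X r $ k" i] CkvD[OF X] by (simp add: numeral_2_eq_2 One_nat_def)
  note reg = CkvD[OF X1] CkvD[OF cX] dX Ck_christoffel[of 1]
  have dcov: "pd c a (\<lambda>r. cov g c i X r $ k) q
      = ?ddx a i k + (\<Sum>j\<in>UNIV. ?d\<Gamma> a k i j * ?x j + ?\<Gamma> k i j * ?dx a j)" for a i k
    unfolding cov_def vec_lambda_beta
    by (simp add: pd_add[OF q] pd_sum[OF q] pd_mult[OF q] Ck_sum Ck_mult reg)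
  have "divergence g c (\<lambda>r. covd g c X r (X r)) q =
      (\<Sum>k\<in>UNIV. (\<Sum>i\<in>UNIV. ?dx k i * ?B i k
        + ?x i * (?ddx k i k + (\<Sum>j\<in>UNIV. ?d\<Gamma> k k i j * ?x j + ?\<Gamma> k i j * ?dx k j)))
      + (\<Sum>j\<in>UNIV. ?\<Gamma> k k j * (\<Sum>i\<in>UNIV. ?x i * ?B i j)))"
    unfolding divergence_def covd_def sum_component vector_scaleR_component real_scaleR_def
    by (simp add: pd_sum[OF q] pd_mult[OF q] Ck_mult reg dcov)
  also have "\<dots> = (\<Sum>i\<in>UNIV. \<Sum>k\<in>UNIV. ?B i k * ?B k i)
      + (\<Sum>i\<in>UNIV. ?x i * (\<Sum>k\<in>UNIV. ?ddx i k k + (\<Sum>j\<in>UNIV. ?d\<Gamma> i k k j * ?x j + ?\<Gamma> k k j * ?dx i j)))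
      + (\<Sum>j\<in>UNIV. \<Sum>k\<in>UNIV. (\<Sum>i\<in>UNIV. ?d\<Gamma> i i j k - ?d\<Gamma> j i i k
          + (\<Sum>m\<in>UNIV. ?\<Gamma> i i m * ?\<Gamma> m j k - ?\<Gamma> i j m * ?\<Gamma> m i k)) * ?x j * ?x k)"
    by (rule bochner_sums[OF christoffel_commute[OF q] pd_commute[OF q CkvD[OF X]]])
      (simp add: cov_def)
  also have "(\<Sum>i\<in>UNIV. \<Sum>k\<in>UNIV. ?B i k * ?B k i) = (\<Sum>i\<in>UNIV. covd g c X q (cov g c i X q) $ i)"
    by (simp add: covd_def)
  also have "(\<Sum>i\<in>UNIV. ?x i * (\<Sum>k\<in>UNIV. ?ddx i k k
      + (\<Sum>j\<in>UNIV. ?d\<Gamma> i k k j * ?x j + ?\<Gamma> k k j * ?dx i j)))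
      = directional c (divergence g c X) q (X q)"
    unfolding directional_def divergence_eq[abs_def]
    by (simp add: pd_sum[OF q] reg dcov)
  also have "(\<Sum>j\<in>UNIV. \<Sum>k\<in>UNIV. (\<Sum>i\<in>UNIV. ?d\<Gamma> i i j k - ?d\<Gamma> j i i k
          + (\<Sum>m\<in>UNIV. ?\<Gamma> i i m * ?\<Gamma> m j k - ?\<Gamma> i j m * ?\<Gamma> m i k)) * ?x j * ?x k)
      = ricci g c q (X q) (X q)"
    by (simp add: ricci_def riemann_def)
  finally show ?thesis .
qed

lemma hess_eq_covd:
  assumes q: "q \<in> W" and h: "Ck 2 h"
  shows "hess g c h q X Y = ginner g c q (covd g c (grad g c h) q X) Y"
proof -
  have Y: "Y = (\<Sum>j\<in>UNIV. Y $ j *\<^sub>R axis j 1)"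
    by (simp add: vec_eq_iff axis_def if_distrib[of "\<lambda>a. _ * a"] cong: if_cong)
  have "ginner g c q (covd g c (grad g c h) q X) (\<Sum>j\<in>UNIV. Y $ j *\<^sub>R axis j 1)
      = (\<Sum>i\<in>UNIV. \<Sum>j\<in>UNIV. X $ i * (Y $ j * hess g c h q (axis i 1) (axis j 1)))"
    by (simp add: covd_def ginner_linear ginner_cov_grad[OF q h] sum_distrib_left,
        subst sum.swap, simp add: mult_ac)
  then show ?thesis
    unfolding Y[symmetric] by (subst hess_eq_sum) (simp add: mult_ac)
qed

lemma hess_commute:
  assumes q: "q \<in> W" and h: "Ck 2 h"
  shows "hess g c h q X Y = hess g c h q Y X"
proof -
  have "hess g c h q (axis i 1) (axis j 1) = hess g c h q (axis j 1) (axis i 1)" for i j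
    unfolding hess_axis using pd_commute[OF q h] christoffel_commute[OF q] by simp
  then have "hess g c h q X Y = (\<Sum>i\<in>UNIV. \<Sum>j\<in>UNIV. hess g c h q (axis j 1) (axis i 1) * (Y $ j * X $ i))"
    by (subst hess_eq_sum) (simp add: mult_ac)
  also have "\<dots> = hess g c h q Y X"
    by (subst sum.swap) (simp add: hess_eq_sum[symmetric])
  finally show ?thesis .
qed

end

section \<open>The weighted \<open>p\<close>-Bochner formula\<close>

text \<open>This is \<open>exp f * div (exp (- f) * Y)\<close> with the exponential already
  differentiated, a form in which \<open>f\<close> enters only through its gradient.\<close>

definition weighted_divergence ::
    "('a, 'n::finite) metric \<Rightarrow> ('a \<Rightarrow> real) \<Rightarrow> ('a, 'n) chart \<Rightarrow> ('a \<Rightarrow> real ^ 'n) \<Rightarrow> 'a \<Rightarrow> real" where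
  "weighted_divergence g f c Y q = divergence g c Y q - ginner g c q (grad g c f q) (Y q)"

lemma laplacian_f_eq: "laplacian_f g f c h q = weighted_divergence g f c (grad g c h) q"
  by (simp add: laplacian_f_def laplacian_def weighted_divergence_def)

lemma A_op_add: "A_op g p c u q (X + Y) = A_op g p c u q X + A_op g p c u q Y"
  by (simp add: A_op_def ginner_add_right distrib_left add_divide_distrib scaleR_add_left)

lemma A_op_scaleR: "A_op g p c u q (a *\<^sub>R X) = a *\<^sub>R A_op g p c u q X"
  by (simp add: A_op_def ginner_scaleR_right algebra_simps)

lemma linear_A_op: "linear (A_op g p c u q)"
  by (rule linearI) (simp_all add: A_op_add A_op_scaleR)

lemma ricci_f_scaleR: "ricci_f g f c q (a *\<^sub>R X) (a *\<^sub>R X) = a\<^sup>2 * ricci_f g f c q X X"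
  by (simp add: ricci_f_def ricci_def hess_def sum_distrib_left power2_eq_square distrib_left mult_ac)

context coordinate_metric
begin

section \<open>The weighted divergence and its Bochner identity\<close>

lemma Ck_minus: "Ck k h \<Longrightarrow> Ck k (\<lambda>q. - h q)"
  using Ck_diff[OF Ck_const[of k 0]] by simp

lemma pd_minus: "q \<in> W \<Longrightarrow> Ck 1 h \<Longrightarrow> pd c i (\<lambda>r. - h r) q = - pd c i h q"
  using pd_diff[of q "\<lambda>_. 0" h i] Ck_const[of 1 0] by (simp add: pd_const)

lemma Ckv_grad_Suc: "Ck 2 h \<Longrightarrow> Ckv 1 (grad g c h)" "Ck 3 h \<Longrightarrow> Ckv 2 (grad g c h)"
  using Ckv_grad[of 1 h] Ckv_grad[of 2 h] by simp_all

lemma Ckv_add: "Ckv k Y \<Longrightarrow> Ckv k Z \<Longrightarrow> Ckv k (\<lambda>q. Y q + Z q)"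
  by (simp add: Ckv_def Ck_add)

context
  fixes q f assumes q: "q \<in> W" and f: "Ck 2 f"
begin

lemma exp_divergence:
  assumes "Ckv 1 Y"
  shows "exp (f q) * divergence g c (\<lambda>r. exp (- f r) *\<^sub>R Y r) q = weighted_divergence g f c Y q"
proof -
  have f1: "Ck 1 f" using Ck_mono[OF f] by simp
  have "directional c (\<lambda>r. exp (- f r)) q v = - exp (- f q) * ginner g c q (grad g c f q) v" for v
    by (simp add: directional_def pd_exp[OF q Ck_minus[OF f1]] pd_minus[OF q f1] ginner_grad[OF q]
        sum_distrib_left sum_negf mult_ac)
  then have "divergence g c (\<lambda>r. exp (- f r) *\<^sub>R Y r) q = exp (- f q) * weighted_divergence g f c Y q"
    unfolding divergence_scaleR[OF q Ck_exp[OF Ck_minus[OF f1]] assms]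
    by (simp add: weighted_divergence_def right_diff_distrib)
  then show ?thesis
    by (simp add: mult.assoc[symmetric] exp_add[symmetric])
qed

lemma weighted_divergence_add:
  assumes "Ckv 1 Y" "Ckv 1 Z"
  shows "weighted_divergence g f c (\<lambda>r. Y r + Z r) q
    = weighted_divergence g f c Y q + weighted_divergence g f c Z q"
  by (simp add: weighted_divergence_def divergence_add[OF q assms] ginner_add_right)

lemma weighted_divergence_scaleR:
  assumes "Ck 1 h" "Ckv 1 Y"
  shows "weighted_divergence g f c (\<lambda>r. h r *\<^sub>R Y r) q
    = directional c h q (Y q) + h q * weighted_divergence g f c Y q"
  by (simp add: weighted_divergence_def divergence_scaleR[OF q assms] ginner_scaleR_right algebra_simps)

text \<open>Along X, the inner product of grad f and X has derivative Hess f (X, X) plus the inner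
  product of grad f with the derivative of X along itself. The latter is the weight term on the
  left, so passing to the weighted divergence adds precisely Hess f (X, X) to Ric.\<close>

lemma weighted_divergence_covd:
  assumes X: "Ckv 2 X"
  shows "weighted_divergence g f c (\<lambda>r. covd g c X r (X r)) q =
    (\<Sum>i\<in>UNIV. covd g c X q (cov g c i X q) $ i)
    + directional c (weighted_divergence g f c X) q (X q) + ricci_f g f c q (X q) (X q)"
proof -
  note reg = Ckv_grad_Suc(1)[OF f] Ckv_mono[OF X, of 1]
  have div: "Ck 1 (divergence g c X)"
    using Ck_divergence[of 1 X] X by simp
  have pd: "pd c i (weighted_divergence g f c X) q = pd c i (divergence g c X) q
      - (ginner g c q (cov g c i (grad g c f) q) (X q) + ginner g c q (grad g c f q) (cov g c i X q))" for i
    unfolding weighted_divergence_def[abs_def]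
    by (simp add: pd_diff[OF q div Ck_ginner[OF reg]] pd_ginner[OF q reg])
  have "directional c (weighted_divergence g f c X) q (X q)
      = directional c (divergence g c X) q (X q) - hess g c f q (X q) (X q)
        - ginner g c q (grad g c f q) (covd g c X q (X q))"
    unfolding hess_eq_covd[OF q f]
    by (simp add: directional_def pd covd_def ginner_linear right_diff_distrib distrib_left
        sum.distrib sum_subtractf)
  then show ?thesis
    by (simp add: weighted_divergence_def divergence_covd[OF q X] ricci_f_def)
qed

end
end

text \<open>The gradient is nonzero on all of \<open>W\<close>, not just at one point, because
  powers of its norm are differentiated.\<close>

locale nonvanishing_gradient = coordinate_metric c g W
  for c :: "('a, 'n::finite) chart" and g :: "('a, 'n) metric" and W :: "'a set" +
  fixes f u :: "'a \<Rightarrow> real" and p :: real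
  assumes f: "Ck 2 f" and u: "Ck 3 u"
    and grad_nz: "q \<in> W \<Longrightarrow> grad_norm g c u q \<noteq> 0"
begin

abbreviation V :: "'a \<Rightarrow> real ^ 'n" where "V \<equiv> grad g c u"
abbreviation w :: "'a \<Rightarrow> real" where "w \<equiv> grad_norm g c u"
abbreviation A :: "'a \<Rightarrow> real ^ 'n \<Rightarrow> real ^ 'n" where "A \<equiv> A_op g p c u"
abbreviation H :: "'a \<Rightarrow> real ^ 'n \<Rightarrow> real ^ 'n" where "H \<equiv> covd g c V"

definition X :: "'a \<Rightarrow> real ^ 'n" where "X q = w q powr (p - 2) *\<^sub>R V q"

section \<open>Powers of |grad u| and the flux field of the p-Laplacian\<close>

lemma u2: "Ck 2 u"
  using Ck_mono[OF u] by simp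

lemma V2: "Ckv 2 V" and V1: "Ckv 1 V"
  using Ckv_grad_Suc[of u] u u2 by auto

lemma speed_sq: "q \<in> W \<Longrightarrow> ginner g c q (V q) (V q) = (w q)\<^sup>2"
  and speed_pos: "q \<in> W \<Longrightarrow> w q > 0"
proof -
  assume q: "q \<in> W"
  have "V q \<noteq> 0"
    using grad_nz[OF q] by (auto simp: grad_norm_def gnorm_def ginner_def)
  from ginner_pos[OF q this] show "ginner g c q (V q) (V q) = (w q)\<^sup>2" "w q > 0"
    by (simp_all add: grad_norm_def gnorm_def)
qed

text \<open>\<open>grad_norm\<close> is a square root; as a power of the positive squared norm,
  every power of it inherits the regularity of the inner product and the chain rule
  \<open>pd_powr\<close>.\<close>

lemma speed_powr: "q \<in> W \<Longrightarrow> w q powr a = ginner g c q (V q) (V q) powr (a / 2)"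
  using speed_pos[of q] by (simp add: speed_sq powr_powr flip: powr_numeral)

lemma Ck_speed_powr: "Ck 2 (\<lambda>q. w q powr a)"
proof (rule Ck_cong)
  show "Ck 2 (\<lambda>q. ginner g c q (V q) (V q) powr (a / 2))"
    by (intro Ck_powr Ck_ginner V2) (simp add: speed_sq grad_nz)
qed (simp add: speed_powr)

lemma Ckv_X: "Ckv 2 X"
  unfolding X_def[abs_def] by (intro Ckv_scaleR Ck_speed_powr V2)

lemmas Ck1_speed_powr = Ck_mono[OF Ck_speed_powr, of 1, simplified]
lemmas X1 = Ckv_mono[OF Ckv_X, of 1, simplified]

context
  fixes q assumes q: "q \<in> W"
begin

lemma pd_speed_powr:
  "pd c i (\<lambda>r. w r powr a) q = a * w q powr (a - 2) * ginner g c q (cov g c i V q) (V q)"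
proof -
  have "pd c i (\<lambda>r. w r powr a) q = pd c i (\<lambda>r. ginner g c r (V r) (V r) powr (a / 2)) q"
    by (rule pd_cong[OF q]) (rule speed_powr)
  also have "\<dots> = a / 2 * ginner g c q (V q) (V q) powr (a / 2 - 1)
      * (2 * ginner g c q (cov g c i V q) (V q))"
    using pd_powr[OF q Ck_ginner[OF V1 V1], where a = "a / 2" and i = i] speed_pos[OF q]
    by (simp add: speed_sq[OF q] pd_ginner[OF q V1 V1] ginner_commute[OF q, of "V q" "cov g c i V q"])
  also have "ginner g c q (V q) (V q) powr (a / 2 - 1) = w q powr (a - 2)"
    by (simp add: speed_powr[OF q] diff_divide_distrib)
  finally show ?thesis by simp
qed

lemma hess_u: "hess g c u q v z = ginner g c q (H q v) z"
  by (rule hess_eq_covd[OF q u2])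

lemma H_sym: "ginner g c q (H q v) z = ginner g c q v (H q z)"
  using hess_commute[OF q u2, of v z] by (simp add: hess_u ginner_commute[OF q, of v "H q z"])

lemma A_sym: "ginner g c q (A q v) z = ginner g c q v (A q z)"
  by (simp add: A_op_def ginner_linear ginner_commute[OF q, of v "V q"])

text \<open>Symmetry of the Hessian moves it from \<open>v\<close> to grad u, leaving an expression
  linear in \<open>v\<close> from which the gradient can be read off.\<close>

lemma directional_speed_powr:
  "directional c (\<lambda>r. w r powr a) q v = a * w q powr (a - 2) * ginner g c q (H q (V q)) v"
proof -
  have "directional c (\<lambda>r. w r powr a) q v = a * w q powr (a - 2) * ginner g c q (H q v) (V q)"
    by (simp add: directional_def pd_speed_powr covd_def ginner_linear sum_distrib_left mult_ac)
  then show ?thesis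
    by (simp add: H_sym[of v "V q"] ginner_commute[OF q, of v])
qed

lemma grad_speed_powr: "grad g c (\<lambda>r. w r powr a) q = (a * w q powr (a - 2)) *\<^sub>R H q (V q)"
  by (rule grad_eqI[OF q]) (simp add: directional_speed_powr ginner_scaleR_left)

text \<open>This and the next two lemmas reduce the exponents to \<open>a - 2\<close> and ordinary
  division by the squared norm, which turns the later comparisons into field arithmetic.\<close>

lemma speed_powr_m4: "w q powr (a - 4) = w q powr (a - 2) / (w q)\<^sup>2"
  using speed_pos[OF q] powr_diff[of "w q" "a - 2" 2] by (simp add: powr_numeral)

lemma speed_powr_neg: "w q powr (- 2) = 1 / (w q)\<^sup>2" "w q powr (- 4) = 1 / ((w q)\<^sup>2)\<^sup>2"
  using speed_pos[OF q] by (simp_all add: powr_minus powr_numeral divide_inverse flip: power_mult)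

lemma speed_powr_double: "w q powr (2 * a - 4) = (w q powr (a - 2))\<^sup>2"
  using powr_add[of "w q" "a - 2" "a - 2"] by (simp add: power2_eq_square)

text \<open>Differentiating the scalar factor of X yields a multiple of grad u with coefficient
  \<open>p - 2\<close>, which is the rank-one part of A; differentiating grad u yields the identity
  part.\<close>

lemma covd_X: "covd g c X q v = w q powr (p - 2) *\<^sub>R A q (H q v)"
proof -
  have "cov g c i X q = w q powr (p - 2) *\<^sub>R A q (cov g c i V q)" for i
    unfolding X_def[abs_def] cov_scaleR[OF q Ck1_speed_powr V1]
    by (simp add: pd_speed_powr A_op_def speed_powr_m4[of p] scaleR_add_right ginner_commute[OF q, of "V q" "cov g c i V q"])
  then show ?thesis
    by (simp add: covd_def linear_sum[OF linear_A_op] A_op_scaleR scaleR_sum_right mult.commute)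
qed

end

lemma p_laplacian_f_eq: "q \<in> W \<Longrightarrow> p_laplacian_f g f p c u q = weighted_divergence g f c X q"
  by (simp add: p_laplacian_f_def exp_divergence[OF _ f X1, symmetric] X_def)

lemma calL_f_speed_powr:
  assumes q: "q \<in> W"
  shows "calL_f g f p c u (\<lambda>r. w r powr p) q = p * weighted_divergence g f c (\<lambda>r. covd g c X r (X r)) q"
proof -
  let ?Y = "\<lambda>r. covd g c X r (X r)"
  have Y: "Ckv 1 ?Y"
    using Ckv_covd[of 1 X X] Ckv_X X1 by simp
  \<comment> \<open>Both factors \<open>w powr (p - 2)\<close> are absorbed, one into the covariant
    derivative of X and one into its direction X. The formulas hold throughout \<open>W\<close>, as
    \<open>divergence_cong\<close> requires.\<close>
  have "divergence g c (\<lambda>r. (exp (- f r) * w r powr (p - 2)) *\<^sub>R A r (grad g c (\<lambda>r. w r powr p) r)) q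
      = divergence g c (\<lambda>r. exp (- f r) *\<^sub>R (p *\<^sub>R ?Y r)) q"
    by (rule divergence_cong[OF q])
      (simp add: grad_speed_powr A_op_scaleR covd_X X_def covd_scaleR mult_ac)
  then have "calL_f g f p c u (\<lambda>r. w r powr p) q = weighted_divergence g f c (\<lambda>r. p *\<^sub>R ?Y r) q"
    by (simp only: calL_f_def exp_divergence[OF q f Ckv_scaleR[OF Ck_const Y]])
  then show ?thesis
    by (simp add: weighted_divergence_scaleR[OF q f Ck_const Y] directional_def pd_const[OF q])
qed

text \<open>The rank-one part of the flux is written as a multiple \<open>?\<beta>\<close> of X, so
  its weighted divergence contains the p-Laplacian directly. Differentiating \<open>?\<beta>\<close>
  along X produces the term of \<open>L_f\<close> with Hess \<psi>.\<close>

lemma calL_f_eq_L_f: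
  assumes q: "q \<in> W" and \<psi>: "Ck 2 \<psi>"
  shows "calL_f g f p c u \<psi> q = L_f g f p c u \<psi> q + (p - 2) *
    (2 * w q powr (p - 4) * ginner g c q (H q (V q)) (grad g c \<psi> q)
      + ginner g c q (V q) (grad g c \<psi> q) * w q powr (- 2) * p_laplacian_f g f p c u q
      - 2 * w q powr (p - 2) * w q powr (- 4) * ginner g c q (V q) (grad g c \<psi> q)
        * ginner g c q (H q (V q)) (V q))"
proof -
  let ?D = "grad g c \<psi>"
  \<comment> \<open>The division by the squared norm is expressed as \<open>powr (- 2)\<close> so
    that \<open>pd_speed_powr\<close> differentiates it.\<close>
  let ?\<beta> = "\<lambda>r. (p - 2) * (ginner g c r (V r) (?D r) * w r powr (- 2))"
  have D: "Ckv 1 ?D" by (rule Ckv_grad_Suc(1)[OF \<psi>])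
  have VD: "Ck 1 (\<lambda>r. ginner g c r (V r) (?D r))" by (rule Ck_ginner[OF V1 D])
  have VDw: "Ck 1 (\<lambda>r. ginner g c r (V r) (?D r) * w r powr (- 2))"
    by (rule Ck_mult[OF VD Ck1_speed_powr])
  have \<beta>: "Ck 1 ?\<beta>" by (rule Ck_mult[OF Ck_const VDw])
  note wD = Ckv_scaleR[OF Ck1_speed_powr D] and \<beta>X = Ckv_scaleR[OF \<beta> X1]
  have "pd c i ?\<beta> q = (p - 2) *
      ((ginner g c q (cov g c i V q) (?D q) + ginner g c q (V q) (cov g c i ?D q)) * w q powr (- 2)
      - 2 * w q powr (- 4) * ginner g c q (V q) (?D q) * ginner g c q (cov g c i V q) (V q))" for i
    unfolding pd_mult[OF q Ck_const VDw] pd_mult[OF q VD Ck1_speed_powr] pd_const[OF q]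
      pd_ginner[OF q V1 D] pd_speed_powr[OF q]
    by (simp add: algebra_simps)
  then have "directional c ?\<beta> q (V q) = (p - 2) *
      ((ginner g c q (H q (V q)) (?D q) + ginner g c q (V q) (covd g c ?D q (V q))) * w q powr (- 2)
      - 2 * w q powr (- 4) * ginner g c q (V q) (?D q) * ginner g c q (H q (V q)) (V q))"
    by (simp add: directional_def covd_def ginner_linear sum_distrib_left sum_distrib_right
        sum.distrib sum_subtractf right_diff_distrib distrib_left distrib_right mult_ac)
  then have dir\<beta>: "directional c ?\<beta> q (X q) = (p - 2) * w q powr (p - 2) *
      ((ginner g c q (H q (V q)) (?D q) + hess g c \<psi> q (V q) (V q)) * w q powr (- 2)
      - 2 * w q powr (- 4) * ginner g c q (V q) (?D q) * ginner g c q (H q (V q)) (V q))"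
    by (simp add: X_def directional_scaleR hess_eq_covd[OF q \<psi>] ginner_commute[OF q, of "V q" "covd g c ?D q (V q)"])
  have "divergence g c (\<lambda>r. (exp (- f r) * w r powr (p - 2)) *\<^sub>R A r (?D r)) q
      = divergence g c (\<lambda>r. exp (- f r) *\<^sub>R (w r powr (p - 2) *\<^sub>R ?D r + ?\<beta> r *\<^sub>R X r)) q"
    by (rule divergence_cong[OF q])
      (simp add: A_op_def X_def speed_powr_neg scaleR_add_right mult_ac)
  then have "calL_f g f p c u \<psi> q
      = weighted_divergence g f c (\<lambda>r. w r powr (p - 2) *\<^sub>R ?D r + ?\<beta> r *\<^sub>R X r) q"
    by (simp only: calL_f_def exp_divergence[OF q f Ckv_add[OF wD \<beta>X]])
  also have "\<dots> = directional c (\<lambda>r. w r powr (p - 2)) q (?D q) + w q powr (p - 2) * laplacian_f g f c \<psi> q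
      + (directional c ?\<beta> q (X q) + ?\<beta> q * p_laplacian_f g f p c u q)"
    by (simp only: weighted_divergence_add[OF q f wD \<beta>X] weighted_divergence_scaleR[OF q f Ck1_speed_powr D]
        weighted_divergence_scaleR[OF q f \<beta> X1] laplacian_f_eq p_laplacian_f_eq[OF q])
  \<comment> \<open>This term equals the one arising when grad u is differentiated inside
    \<open>?\<beta>\<close>; together they account for the first factor 2 in the claim.\<close>
  also have "directional c (\<lambda>r. w r powr (p - 2)) q (?D q)
      = (p - 2) * w q powr (p - 4) * ginner g c q (H q (V q)) (?D q)"
    by (simp add: directional_speed_powr[OF q])
  moreover have "w q powr (p - 4) = w q powr (p - 2) * w q powr (- 2)"
    by (simp add: speed_powr_m4[OF q] speed_powr_neg[OF q])
  ultimately show ?thesis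
    unfolding dir\<beta> L_f_def by (simp only: ring_distribs) simp
qed

text \<open>Parseval removes the indices \<open>l\<close>, \<open>j\<close> and one of the remaining
  two. Self-adjointness of A and of the Hessian, used separately, lines the operators up as the
  composite whose trace remains.\<close>

lemma hess_A_norm_sq_trace:
  assumes q: "q \<in> W" and e: "orthonormal_frame g c q e"
  shows "hess_A_norm_sq g p c e u q = (\<Sum>i\<in>UNIV. ginner g c q (e i) (A q (H q (A q (H q (e i))))))"
proof -
  let ?G = "ginner g c q" and ?A = "A q" and ?H = "H q"
  have swap: "?G (?H v) (?A z) = ?G z (?A (?H v))" for v z
    using A_sym[OF q, of z "?H v"] ginner_commute[OF q, of "?H v" "?A z"] by simp
  have A_commute: "?G (?A v) z = ?G (?A z) v" for v z
    using A_sym[OF q, of v z] ginner_commute[OF q, of v "?A z"] by simp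
  have "hess_A_norm_sq g p c e u q = (\<Sum>i\<in>UNIV. \<Sum>j\<in>UNIV. \<Sum>k\<in>UNIV. \<Sum>l\<in>UNIV.
      ?G (?A (e i)) (e k) * ?G (?H (e i)) (e j) * (?G (?H (e k)) (e l) * ?G (e l) (?A (e j))))"
    by (simp add: hess_A_norm_sq_def A_comp_def hess_u[OF q] ginner_commute[OF q, of "e _" "?A _"] mult_ac)
  also have "\<dots> = (\<Sum>i\<in>UNIV. \<Sum>j\<in>UNIV. \<Sum>k\<in>UNIV.
      ?G (?A (e i)) (e k) * (?G (?H (e i)) (e j) * ?G (e j) (?A (?H (e k)))))"
    by (simp only: parseval[OF e] sum_distrib_left[symmetric] mult.assoc swap)
  also have "\<dots> = (\<Sum>i\<in>UNIV. \<Sum>k\<in>UNIV. \<Sum>j\<in>UNIV.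
      ?G (?A (e i)) (e k) * (?G (?H (e i)) (e j) * ?G (e j) (?A (?H (e k)))))"
    by (rule sum.cong[OF refl]) (rule sum.swap)
  also have "\<dots> = (\<Sum>i\<in>UNIV. \<Sum>k\<in>UNIV. ?G (?A (e i)) (e k) * ?G (?H (e i)) (?A (?H (e k))))"
    by (simp only: parseval[OF e] sum_distrib_left[symmetric])
  also have "\<dots> = (\<Sum>k\<in>UNIV. \<Sum>i\<in>UNIV. ?G (?A (e k)) (e i) * ?G (e i) (?H (?A (?H (e k)))))"
    by (subst sum.swap) (simp only: H_sym[OF q] A_commute)
  also have "\<dots> = (\<Sum>k\<in>UNIV. ?G (e k) (?A (?H (?A (?H (e k))))))"
    by (simp only: parseval[OF e]) (simp only: A_sym[OF q])
  finally show ?thesis .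
qed

text \<open>Each of the two covariant derivatives of X contributes a factor
  \<open>w powr (p - 2)\<close>, which gives the exponent \<open>2 * p - 4\<close>.\<close>

lemma trace_covd_X:
  assumes q: "q \<in> W" and e: "orthonormal_frame g c q e"
  shows "(\<Sum>i\<in>UNIV. covd g c X q (cov g c i X q) $ i) = w q powr (2 * p - 4) * hess_A_norm_sq g p c e u q"
proof -
  let ?G = "ginner g c q" and ?A = "A q" and ?H = "H q"
  have "(\<Sum>i\<in>UNIV. covd g c X q (cov g c i X q) $ i)
      = (\<Sum>i\<in>UNIV. (covd g c X q \<circ> covd g c X q) (axis i 1) $ i)"
    by (simp add: covd_axis)
  also have "\<dots> = (\<Sum>i\<in>UNIV. ?G (e i) ((covd g c X q \<circ> covd g c X q) (e i)))"
    by (intro trace_orthonormal_frame e linear_compose linear_covd)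
  also have "\<dots> = w q powr (2 * p - 4) * (\<Sum>i\<in>UNIV. ?G (e i) (?A (?H (?A (?H (e i))))))"
    unfolding speed_powr_double[OF q]
    by (simp add: covd_X[OF q] covd_scaleR A_op_scaleR ginner_scaleR_right sum_distrib_left
        power2_eq_square mult_ac)
  finally show ?thesis
    by (simp only: hess_A_norm_sq_trace[OF q e])
qed

text \<open>With A the identity plus \<open>\<beta>\<close> times the square of grad u, both cross
  terms equal \<open>\<beta>\<close> times the squared norm of Hess u (grad u), by symmetry; the
  term in the square of \<open>\<beta>\<close> is the squared infinity-Laplacian.\<close>

lemma hess_A_norm_sq_eq:
  assumes q: "q \<in> W" and e: "orthonormal_frame g c q e"
  shows "hess_A_norm_sq g p c e u q = hess_norm_sq g c e u q
    + 2 * (p - 2) / (w q)\<^sup>2 * ginner g c q (H q (V q)) (H q (V q)) + (p - 2)\<^sup>2 * (inf_laplacian g c u q)\<^sup>2"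
proof -
  let ?G = "ginner g c q" and ?H = "H q" and ?V = "V q"
  define \<beta> where "\<beta> = (p - 2) / (w q)\<^sup>2"
  have A: "A q y = y + (\<beta> * ?G ?V y) *\<^sub>R ?V" for y
    by (simp add: A_op_def \<beta>_def)
  \<comment> \<open>All summands but the first are arranged as products of two frame coefficients,
    ready for Parseval; the first sums to the squared norm of the Hessian.\<close>
  have "?G (e i) (A q (?H (A q (?H (e i))))) = ?G (?H (e i)) (?H (e i))
      + \<beta> * (?G (?H ?V) (e i) * ?G (e i) (?H ?V)) + \<beta> * (?G (?H (?H ?V)) (e i) * ?G (e i) ?V)
      + \<beta>\<^sup>2 * ?G ?V (?H ?V) * (?G (?H ?V) (e i) * ?G (e i) ?V)" for i
    unfolding A covd_add covd_scaleR ginner_linear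
    by (simp add: H_sym[OF q] power2_eq_square algebra_simps)
  then have "hess_A_norm_sq g p c e u q = (\<Sum>i\<in>UNIV. ?G (?H (e i)) (?H (e i)))
      + \<beta> * ?G (?H ?V) (?H ?V) + \<beta> * ?G (?H (?H ?V)) ?V + \<beta>\<^sup>2 * ?G ?V (?H ?V) * ?G (?H ?V) ?V"
    by (simp add: hess_A_norm_sq_trace[OF q e] sum.distrib sum_distrib_left[symmetric] parseval[OF e])
  also have "(\<Sum>i\<in>UNIV. ?G (?H (e i)) (?H (e i))) = hess_norm_sq g c e u q"
    unfolding hess_norm_sq_def hess_u[OF q] power2_eq_square
    by (subst (2) ginner_commute[OF q]) (simp add: parseval[OF e])
  also have "?G (?H (?H ?V)) ?V = ?G (?H ?V) (?H ?V)"
    by (rule H_sym[OF q])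
  also have "\<beta>\<^sup>2 * ?G ?V (?H ?V) * ?G (?H ?V) ?V = (p - 2)\<^sup>2 * (inf_laplacian g c u q)\<^sup>2"
    by (simp add: inf_laplacian_def hess_u[OF q] \<beta>_def ginner_commute[OF q, of ?V "?H ?V"]
        power2_eq_square)
  finally show ?thesis
    by (simp add: \<beta>_def)
qed

text \<open>The two powers in the formula reflect homogeneity: trace and Ricci term are quadratic in
  X, while the derivative of the p-Laplacian along X is linear.\<close>

lemma p_bochner_linearized:
  assumes q: "q \<in> W" and e: "orthonormal_frame g c q e" and "p \<noteq> 0"
  shows "1 / p * calL_f g f p c u (\<lambda>r. w r powr p) q =
    w q powr (2 * p - 4) * (hess_A_norm_sq g p c e u q + ricci_f g f c q (V q) (V q))
    + w q powr (p - 2) * ginner g c q (V q) (grad g c (p_laplacian_f g f p c u) q)"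
proof -
  have "directional c (weighted_divergence g f c X) q (X q)
      = w q powr (p - 2) * ginner g c q (V q) (grad g c (p_laplacian_f g f p c u) q)"
  proof -
    \<comment> \<open>The p-Laplacian is identified with the weighted divergence on
      \<open>W\<close>, so their derivatives agree by locality.\<close>
    have "pd c i (weighted_divergence g f c X) q = pd c i (p_laplacian_f g f p c u) q" for i
      by (rule pd_cong[OF q]) (simp add: p_laplacian_f_eq)
    then have "directional c (weighted_divergence g f c X) q (X q)
        = directional c (p_laplacian_f g f p c u) q (X q)"
      by (simp add: directional_def)
    then show ?thesis
      by (simp add: X_def directional_scaleR ginner_grad[OF q, where h = "p_laplacian_f g f p c u"]
          ginner_commute[OF q, of "V q" "grad g c (p_laplacian_f g f p c u) q"])
  qed
  moreover have "ricci_f g f c q (X q) (X q) = w q powr (2 * p - 4) * ricci_f g f c q (V q) (V q)"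
    by (simp only: X_def ricci_f_scaleR speed_powr_double[OF q])
  ultimately have "calL_f g f p c u (\<lambda>r. w r powr p) q
      = p * (w q powr (2 * p - 4) * (hess_A_norm_sq g p c e u q + ricci_f g f c q (V q) (V q))
    + w q powr (p - 2) * ginner g c q (V q) (grad g c (p_laplacian_f g f p c u) q))"
    by (simp add: calL_f_speed_powr[OF q] weighted_divergence_covd[OF q f Ckv_X] trace_covd_X[OF q e]
        algebra_simps)
  then show ?thesis
    using \<open>p \<noteq> 0\<close> by simp
qed

text \<open>The squared norm of Hess u (grad u) occurs with the same coefficient in the A-norm and
  in the correction between the two operators, so it cancels. For the squared infinity-Laplacian,
  (p-2)^2 + 2(p-2) = p(p-2).\<close>

lemma p_bochner:
  assumes q: "q \<in> W" and e: "orthonormal_frame g c q e" and "p \<noteq> 0"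
  shows "1 / p * L_f g f p c u (\<lambda>r. w r powr p) q =
    w q powr (2 * p - 4) * (hess_norm_sq g c e u q + p * (p - 2) * (inf_laplacian g c u q)\<^sup>2
      + ricci_f g f c q (V q) (V q))
    + w q powr (p - 2) * (ginner g c q (grad g c (p_laplacian_f g f p c u) q) (V q)
      - (p - 2) * inf_laplacian g c u q * p_laplacian_f g f p c u q)"
proof -
  let ?K = "ginner g c q (H q (V q)) (H q (V q))" and ?\<Delta> = "inf_laplacian g c u q"
    and ?P = "p_laplacian_f g f p c u q" and ?a = "w q powr (p - 2)" and ?s = "(w q)\<^sup>2"
  have s: "?s > 0" using speed_pos[OF q] by simp
  have D: "ginner g c q (H q (V q)) (V q) = ?\<Delta> * ?s" "ginner g c q (V q) (H q (V q)) = ?\<Delta> * ?s"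
    using s by (simp_all add: inf_laplacian_def hess_u[OF q] ginner_commute[OF q, of "V q" "H q (V q)"])
  \<comment> \<open>The correction is evaluated at \<psi> = |grad u|^p, whose gradient is
    \<open>p * ?a\<close> times Hess u (grad u); its inner product with grad u is
    \<open>p * ?a * (?\<Delta> * ?s)\<close>.\<close>
  have "calL_f g f p c u (\<lambda>r. w r powr p) q = L_f g f p c u (\<lambda>r. w r powr p) q + (p - 2) *
      (2 * (?a / ?s) * (p * ?a * ?K) + p * ?a * (?\<Delta> * ?s) * (1 / ?s) * ?P
        - 2 * ?a * (1 / ?s\<^sup>2) * (p * ?a * (?\<Delta> * ?s)) * (?\<Delta> * ?s))"
    unfolding calL_f_eq_L_f[OF q Ck_speed_powr] grad_speed_powr[OF q] ginner_scaleR_right D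
      speed_powr_m4[OF q] speed_powr_neg[OF q] ..
  also have "\<dots> = L_f g f p c u (\<lambda>r. w r powr p) q
      + p * ((p - 2) * (2 * ?a\<^sup>2 / ?s * ?K + ?a * ?\<Delta> * ?P - 2 * ?a\<^sup>2 * ?\<Delta>\<^sup>2))"
    using s by (simp add: field_simps power2_eq_square)
  finally have "1 / p * L_f g f p c u (\<lambda>r. w r powr p) q = 1 / p * calL_f g f p c u (\<lambda>r. w r powr p) q
      - (p - 2) * (2 * ?a\<^sup>2 / ?s * ?K + ?a * ?\<Delta> * ?P - 2 * ?a\<^sup>2 * ?\<Delta>\<^sup>2)"
    using \<open>p \<noteq> 0\<close> by (simp add: field_simps)
  then show ?thesis
    unfolding p_bochner_linearized[OF assms] hess_A_norm_sq_eq[OF q e] speed_powr_double[OF q]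
      ginner_commute[OF q, of "V q" "grad g c (p_laplacian_f g f p c u) q"]
    by (simp add: algebra_simps power2_eq_square)
qed
end

section \<open>Localization to the nonvanishing gradient set in one chart\<close>

theorem lemma2p1:
  fixes \<A> :: "('a::{t2_space, second_countable_topology}, 'n::finite) chart set"
    and g :: "('a, 'n) metric"
    and f u :: "'a \<Rightarrow> real"
    and \<mu> :: "'a measure"
    and p :: real
    and c :: "('a, 'n) chart"
    and q :: 'a
    and e :: "'n \<Rightarrow> real ^ 'n"
  assumes "1 < p"
    and "smooth_metric_measure_space \<A> g f \<mu>"
    and "Ck_fun 3 \<A> u"
    and "c \<in> \<A>" and "q \<in> chart_dom c"
    and "grad_norm g c u q \<noteq> 0"
    and "orthonormal_frame g c q e"
  shows "(1 / p * L_f g f p c u (\<lambda>r. grad_norm g c u r powr p) q =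
      grad_norm g c u q powr (2 * p - 4) *
        (hess_norm_sq g c e u q + p * (p - 2) * (inf_laplacian g c u q)\<^sup>2
          + ricci_f g f c q (grad g c u q) (grad g c u q))
      + grad_norm g c u q powr (p - 2) *
        (ginner g c q (grad g c (p_laplacian_f g f p c u) q) (grad g c u q)
          - (p - 2) * inf_laplacian g c u q * p_laplacian_f g f p c u q))
    \<and>
      (1 / p * calL_f g f p c u (\<lambda>r. grad_norm g c u r powr p) q =
      grad_norm g c u q powr (2 * p - 4) *
        (hess_A_norm_sq g p c e u q + ricci_f g f c q (grad g c u q) (grad g c u q))
      + grad_norm g c u q powr (p - 2) *
        ginner g c q (grad g c u q) (grad g c (p_laplacian_f g f p c u) q))"
proof -
  have p: "p \<noteq> 0" using assms(1) by simp
  have c: "open (chart_image c)" "homeomorphism (chart_dom c) (chart_image c) (snd c) (chart_inv c)"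
    and g: "\<And>k. Ck_on k (chart_image c) (g c \<circ> chart_inv c)"
      "\<And>r. r \<in> chart_dom c \<Longrightarrow> transpose (g c r) = g c r"
      "\<And>r v. r \<in> chart_dom c \<Longrightarrow> v \<noteq> 0 \<Longrightarrow> v \<bullet> (g c r *v v) > 0"
    and f: "Ck_on 2 (chart_image c) (f \<circ> chart_inv c)"
    and u: "Ck_on 3 (chart_image c) (u \<circ> chart_inv c)"
    using assms(2-4)
    unfolding smooth_metric_measure_space_def smooth_atlas_def riemannian_metric_def smooth_fun_def Ck_fun_def
    by blast+
  have inj: "inj_on (snd c) (chart_dom c)"
    using c(2) by (auto simp: homeomorphism_def intro: inj_on_inverseI)
  \<comment> \<open>On the whole chart domain first: the continuity that makes the image of
    \<open>W\<close> open has to be known there.\<close>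
  interpret chart: coordinate_metric c g "chart_dom c"
    by unfold_locales (use inj c(1) g in auto)
  define W where "W = {r \<in> chart_dom c. grad_norm g c u r \<noteq> 0}"
  have open_W: "open (snd c ` W)"
  proof -
    \<comment> \<open>The squared norm has the same zeros as \<open>grad_norm\<close>, and its
      continuity follows from that of the metric and the gradient.\<close>
    let ?s = "\<lambda>r. ginner g c r (grad g c u r) (grad g c u r)"
    have "chart.Ck 0 ?s"
      using u by (intro chart.Ck_ginner chart.Ckv_mono[OF chart.Ckv_grad_Suc(2)])
        (simp_all add: chart.Ck_def)
    then have "continuous_on (chart_image c) (?s \<circ> chart_inv c)"
      by (simp add: chart.Ck_def)
    then have "open (chart_image c \<inter> (?s \<circ> chart_inv c) -` (- {0}))"
      using c(1) by (rule continuous_open_preimage) auto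
    also have "chart_image c \<inter> (?s \<circ> chart_inv c) -` (- {0}) = snd c ` W"
      unfolding W_def using inj by (auto simp: grad_norm_def gnorm_def)
    finally show ?thesis .
  qed
  have sub: "W \<subseteq> chart_dom c" "snd c ` W \<subseteq> chart_image c"
    and nz: "\<And>r. r \<in> W \<Longrightarrow> grad_norm g c u r \<noteq> 0"
    by (auto simp: W_def)
  interpret coordinate_metric c g W
    using sub inj open_W g(2,3) Ck_on_subset[OF sub(2) g(1)] by unfold_locales auto
  interpret nonvanishing_gradient c g W f u p
    using Ck_on_subset[OF sub(2) f] Ck_on_subset[OF sub(2) u] nz by unfold_locales (auto simp: Ck_def)
  have "q \<in> W"
    using assms(5,6) by (simp add: W_def)
  with p_bochner p_bochner_linearized p assms(7) show ?thesis
    by blast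
qed

end
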